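(* Let $Z$ be an interval of $N\ge1$ consecutive integers, let $\mathcal{P}$ be a finite set of primes, and for each $p\in\mathcal{P}$ let $\kappa_p$ be an integer with $0\le\kappa_p<p$. Let $D$ be a finite set of products of distinct primes from $\mathcal{P}$, with $1\in D$. Let $0<\delta\le1$ be such that the fractions $a/d$ with $d\in D$ and $a\in(\mathbb{Z}/d)^\times$ are $\delta$-spaced in $\mathbb{R}/\mathbb{Z}$. For $d\in D$ put $\kappa(d)=\prod_{p\mid d}\kappa_p$, $\phi_\kappa(d)=\prod_{p\mid d}(p-\kappa_p)$, and let $G=\sum_{d\in D}\frac{\kappa(d)}{\phi_\kappa(d)}$. With $M_d$ as defined in the context, set $$B^1=\frac1G\Big((N+\delta^{-1}-1)I-\sum_{d\in D}M_d\Big),\qquad B^d=\frac1G\Big(M_d-\frac{\kappa(d)}{\phi_\kappa(d)}J\Big)\quad(d\in D,\ d>1).$$ Then $B^1$ is positive semidefinite, $B^d\in\mathcal{B}_{d,\kappa}$ for every $d\in D$ with $d>1$, and $$\sum_{d\in D}B^d+J=\frac{N+\delta^{-1}-1}{\sum_{d\in D}\frac{\kappa(d)}{\phi_\kappa(d)}}\,I .$$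
   Context: All matrices are real symmetric with rows and columns indexed by $Z$; $I$ is the identity matrix and $J$ the all-ones matrix. For a product $d$ of distinct primes, $M_d$ is the $Z\times Z$ matrix (denoted $\bigotimes_{p\in d}(pI_p-J_p)\otimes\bigotimes_{q\notin d}J_q$, restricted to $Z$) with entries $(M_d)_{ij}=\prod_{p\mid d}\big(p\cdot\mathbf{1}[p\mid i-j]-1\big)$; in particular $M_1=J$. $\mathcal{B}_{d,\kappa}$ is the set of real symmetric $Z\times Z$ matrices $B$ such that for every choice, for each prime $p\mid d$, of $\kappa_p$ distinct residue classes modulo $p$, the principal submatrix of $B$ obtained by deleting all rows and columns indexed by elements of $Z$ lying in a chosen class is positive semidefinite. Points are $\delta$-spaced in $\mathbb{R}/\mathbb{Z}$ if any two distinct ones among them are at distance at least $\delta$ modulo 1. *)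

theory Defs
  imports "HOL-Analysis.Analysis" "HOL-Computational_Algebra.Primes"
begin

text \<open>A real matrix with rows and columns indexed by a finite set of integers is a function
  \<open>int \<Rightarrow> int \<Rightarrow> real\<close>, only its values on that index set being relevant. Passing to a principal
  submatrix means shrinking the index set.\<close>

type_synonym zmat = "int \<Rightarrow> int \<Rightarrow> real"

definition id_mat :: zmat where
  "id_mat i j = (if i = j then 1 else 0)"

definition ones_mat :: zmat where
  "ones_mat i j = 1"

definition sym_on :: "int set \<Rightarrow> zmat \<Rightarrow> bool" where
  "sym_on S A \<longleftrightarrow> (\<forall>i\<in>S. \<forall>j\<in>S. A i j = A j i)"

definition psd_on :: "int set \<Rightarrow> zmat \<Rightarrow> bool" where
  "psd_on S A \<longleftrightarrow> sym_on S A \<and> (\<forall>x :: int \<Rightarrow> real. 0 \<le> (\<Sum>i\<in>S. \<Sum>j\<in>S. x i * A i j * x j))"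

definition M_mat :: "nat \<Rightarrow> zmat" where
  "M_mat d i j = (\<Prod>p\<in>prime_factors d. real p * of_bool (int p dvd i - j) - 1)"

lemma M_mat_1: "M_mat 1 = ones_mat"
  by (intro ext) (simp add: M_mat_def ones_mat_def)

text \<open>\<open>R p\<close> is the set of chosen residue classes modulo \<open>p\<close>, each class being given by its
  representative in \<open>{0..<p}\<close>; its values at primes not dividing \<open>d\<close> are irrelevant.\<close>

definition B_class :: "int set \<Rightarrow> nat \<Rightarrow> (nat \<Rightarrow> nat) \<Rightarrow> zmat set" where
  "B_class Z d \<kappa> = {B. sym_on Z B \<and>
     (\<forall>R :: nat \<Rightarrow> int set.
        (\<forall>p\<in>prime_factors d. R p \<subseteq> {0..<int p} \<and> card (R p) = \<kappa> p) \<longrightarrow>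
        psd_on (Z - {i. \<exists>p\<in>prime_factors d. i mod int p \<in> R p}) B)}"

text \<open>A set of points of the circle \<open>\<real>/\<int>\<close> is given by a set \<open>X\<close> of real representatives; two
  representatives name distinct points iff their difference is not an integer, and the distance
  modulo 1 is the distance from the difference to the nearest integer.\<close>

definition spaced_mod_1 :: "real \<Rightarrow> real set \<Rightarrow> bool" where
  "spaced_mod_1 \<delta> X \<longleftrightarrow> (\<forall>x\<in>X. \<forall>y\<in>X. x - y \<notin> \<int> \<longrightarrow> \<delta> \<le> infdist (x - y) \<int>)"

definition reduced_fractions :: "nat set \<Rightarrow> real set" where
  "reduced_fractions D = {of_int a / of_nat d | a d. d \<in> D \<and> coprime a (int d)}"

definition kappa_prod :: "(nat \<Rightarrow> nat) \<Rightarrow> nat \<Rightarrow> real" where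
  "kappa_prod \<kappa> d = (\<Prod>p\<in>prime_factors d. real (\<kappa> p))"

definition phi_kappa :: "(nat \<Rightarrow> nat) \<Rightarrow> nat \<Rightarrow> real" where
  "phi_kappa \<kappa> d = (\<Prod>p\<in>prime_factors d. real p - real (\<kappa> p))"

definition G_sum :: "(nat \<Rightarrow> nat) \<Rightarrow> nat set \<Rightarrow> real" where
  "G_sum \<kappa> D = (\<Sum>d\<in>D. kappa_prod \<kappa> d / phi_kappa \<kappa> d)"

definition B_mat :: "nat \<Rightarrow> real \<Rightarrow> (nat \<Rightarrow> nat) \<Rightarrow> nat set \<Rightarrow> nat \<Rightarrow> zmat" where
  "B_mat N \<delta> \<kappa> D d i j =
     (if d = 1
      then 1 / G_sum \<kappa> D * ((real N + inverse \<delta> - 1) * id_mat i j - (\<Sum>e\<in>D. M_mat e i j))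
      else 1 / G_sum \<kappa> D * (M_mat d i j - kappa_prod \<kappa> d / phi_kappa \<kappa> d * ones_mat i j))"

end

theory Submission imports Defs begin

text \<open>
  Expanding each factor \<open>p \<cdot> 1[p dvd i - j] - 1\<close> of \<open>M\<^sub>d\<close> as \<open>\<Sum>a=1..<p. e(a (i - j) / p)\<close> shows that
  \<open>\<Sum>d\<in>D. M\<^sub>d\<close> is the kernel \<open>\<Sum>\<alpha>. e(\<alpha> (i - j))\<close> over the reduced fractions \<open>\<alpha>\<close>, so that positivity of
  \<open>B\<^sup>1\<close> is the analytic large sieve inequality with the sharp constant \<open>N + 1/\<delta> - 1\<close>. By duality the
  large sieve is a bound for the Dirichlet kernel \<open>sin (\<pi>N\<theta>) / sin (\<pi>\<theta>)\<close> on differences of the \<open>\<alpha>\<close>, and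
  hence follows from a bound for the norm of the skew-symmetric matrix \<open>1 / sin (\<pi>(\<alpha>\<^sub>r - \<alpha>\<^sub>s))\<close>. The latter
  is the argument of Montgomery and Vaughan: by the addition theorem for the cotangent, the square of
  this matrix is a matrix of size \<open>O(1 / sin\<^sup>2)\<close> plus a commutator with a diagonal matrix, and the commutator
  drops out on top eigenvectors. The loss of a bounded amount in the constant is removed by a dilation
  argument of Cohen.

  For \<open>d > 1\<close>, outside \<open>\<kappa>\<^sub>p\<close> classes modulo \<open>p\<close> the factor at \<open>p\<close> is \<open>\<kappa>\<^sub>p / (p - \<kappa>\<^sub>p)\<close> plus a Gram kernel, and
  products with Gram kernels preserve positive semidefiniteness.
\<close>

section \<open>Norms of skew-symmetric matrices\<close>

text \<open>Existence of a top singular vector: a continuous function attains its maximum on the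
  compact unit sphere, and homogeneity carries the bound from unit vectors to every
  \<open>x\<close>.\<close>

lemma quadratic_form_attains_sup:
  fixes A :: "'a \<Rightarrow> 'a \<Rightarrow> real"
  assumes fin: "finite S" and ne: "S \<noteq> {}"
  obtains u where "(\<Sum>i\<in>S. (u i)\<^sup>2) = 1"
    and "\<And>x. (\<Sum>i\<in>S. (\<Sum>j\<in>S. A i j * x j)\<^sup>2)
               \<le> (\<Sum>i\<in>S. (\<Sum>j\<in>S. A i j * u j)\<^sup>2) * (\<Sum>i\<in>S. (x i)\<^sup>2)"
proof -
  define q where "q = (\<lambda>x. \<Sum>i\<in>S. (\<Sum>j\<in>S. A i j * x j)\<^sup>2)"
  define nrm where "nrm = (\<lambda>x::'a \<Rightarrow> real. \<Sum>i\<in>S. (x i)\<^sup>2)"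
  \<comment> \<open>Coordinates outside \<open>S\<close> are frozen at 0, so unit vectors extended
    by 0 lie in a product of compact sets even when the type \<open>'a\<close> is infinite.\<close>
  define B where "B = (\<Pi>\<^sub>E i\<in>(UNIV::'a set). if i \<in> S then {-1..1::real} else {0})"
  define K where "K = B \<inter> {x. nrm x = 1}"
  have "compactin (product_topology (\<lambda>i. euclidean) UNIV) B"
    unfolding B_def compactin_PiE by auto
  then have cB: "compact B"
    by (simp add: euclidean_product_topology)
  have cn: "continuous_on UNIV nrm" unfolding nrm_def
    by (intro continuous_intros continuous_on_product_coordinates)
  have "closed {x. nrm x = 1}"
    using continuous_closed_preimage_constant[OF cn, of 1] by simp
  then have cK: "compact K" unfolding K_def by (rule compact_Int_closed[OF cB])
  have cq: "continuous_on K q" unfolding q_def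
    by (intro continuous_intros continuous_on_subset[OF continuous_on_product_coordinates]) auto
  have inK: "(\<lambda>i. if i \<in> S then x i else 0) \<in> K" if "nrm x = 1" for x
  proof -
    have "\<bar>x i\<bar> \<le> 1" if "i \<in> S" for i
    proof -
      have "(x i)\<^sup>2 \<le> nrm x" unfolding nrm_def using fin that
        by (intro member_le_sum) auto
      then show ?thesis using \<open>nrm x = 1\<close> by (simp add: abs_square_le_1)
    qed
    moreover have "nrm (\<lambda>i. if i \<in> S then x i else 0) = nrm x"
      unfolding nrm_def by (intro sum.cong) auto
    ultimately show ?thesis using that unfolding K_def B_def by (auto simp: abs_le_iff)
  qed
  have qext: "q (\<lambda>i. if i \<in> S then x i else 0) = q x" for x
    unfolding q_def by (intro sum.cong refl arg_cong[where f = "\<lambda>t. t\<^sup>2"]) auto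
  obtain i0 where i0: "i0 \<in> S" using ne by auto
  have "nrm (\<lambda>i. if i = i0 then 1 else 0) = (\<Sum>i\<in>S. if i = i0 then 1 else 0)"
    unfolding nrm_def by (intro sum.cong) auto
  also have "\<dots> = 1" using fin i0 by (simp add: sum.delta)
  finally have "K \<noteq> {}" using inK by blast
  from continuous_attains_sup[OF cK this cq]
  obtain u where u: "u \<in> K" "\<And>y. y \<in> K \<Longrightarrow> q y \<le> q u" by auto
  have "q x \<le> q u * nrm x" for x
  proof (cases "nrm x = 0")
    case True
    then have "\<forall>i\<in>S. x i = 0" unfolding nrm_def using fin by (simp add: sum_nonneg_eq_0_iff)
    then have "q x = 0" unfolding q_def by simp
    then show ?thesis using True by simp
  next
    case False
    then have pos: "nrm x > 0" unfolding nrm_def by (simp add: less_le sum_nonneg)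
    define c where "c = 1 / sqrt (nrm x)"
    have c2: "c\<^sup>2 * nrm x = 1" using pos by (simp add: c_def power_divide)
    have "nrm (\<lambda>i. c * x i) = c\<^sup>2 * nrm x"
      unfolding nrm_def by (simp add: power_mult_distrib sum_distrib_left)
    then have "q (\<lambda>i. c * x i) \<le> q u" using u(2)[OF inK] c2 qext by metis
    moreover have "q (\<lambda>i. c * x i) = c\<^sup>2 * q x"
      unfolding q_def
      by (simp add: sum_distrib_left power_mult_distrib mult.left_commute flip: sum_distrib_left)
    ultimately have "c\<^sup>2 * q x * nrm x \<le> q u * nrm x" using pos by simp
    then show ?thesis using c2 by (metis mult.assoc mult.commute mult_1)
  qed
  moreover have "nrm u = 1" using u(1) by (simp add: K_def)
  ultimately show ?thesis using that unfolding q_def nrm_def by blast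
qed

text \<open>For a maximiser \<open>u\<close> with maximum \<open>mu\<close>, skewness forces A^2 u =
  -mu u. The commutator with the diagonal matrix \<open>C\<close> then contributes -2X to the form
  at \<open>u\<close> and +2 mu X to the form at \<open>v\<close> = A u. Weighting the first by
  \<open>mu\<close> and adding cancels X, leaving 2 mu^2 \<le> 2 mu M.\<close>

lemma skew_matrix_norm_bound:
  fixes A E :: "'a \<Rightarrow> 'a \<Rightarrow> real"
  assumes fin: "finite S"
    and skew: "\<And>r s. r \<in> S \<Longrightarrow> s \<in> S \<Longrightarrow> A s r = - A r s"
    and comm: "\<And>r t. r \<in> S \<Longrightarrow> t \<in> S \<Longrightarrow>
      (\<Sum>s\<in>S. A r s * A t s) = E r t + A r t * (C t - C r)"
    and bound: "\<And>x. (\<Sum>r\<in>S. \<Sum>t\<in>S. x r * E r t * x t) \<le> M * (\<Sum>r\<in>S. (x r)\<^sup>2)"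
    and M: "M \<ge> 0"
  shows "(\<Sum>r\<in>S. (\<Sum>s\<in>S. A r s * x s)\<^sup>2) \<le> M * (\<Sum>r\<in>S. (x r)\<^sup>2)"
proof (cases "S = {}")
  case False
  define q where "q = (\<lambda>x. \<Sum>i\<in>S. (\<Sum>j\<in>S. A i j * x j)\<^sup>2)"
  define nrm where "nrm = (\<lambda>x::'a \<Rightarrow> real. \<Sum>i\<in>S. (x i)\<^sup>2)"
  define e where "e = (\<lambda>x. \<Sum>r\<in>S. \<Sum>t\<in>S. x r * E r t * x t)"
  obtain u where u1: "nrm u = 1" and umax: "\<And>x. q x \<le> q u * nrm x"
    unfolding q_def nrm_def by (rule quadratic_form_attains_sup[OF fin False, where A = A]) blast
  have skew_sum: "(\<Sum>r\<in>S. A r s * x r) = - (\<Sum>r\<in>S. A s r * x r)" if "s \<in> S" for s x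
    unfolding sum_negf[symmetric]
  proof (intro sum.cong refl)
    fix r assume "r \<in> S"
    from skew[OF that this] show "A r s * x r = - (A s r * x r)" by simp
  qed
  \<comment> \<open>By skewness the norm can be computed from the transpose, whose Gram matrix is
    the one in \<open>comm\<close>. Skewness also makes the two commutator sums opposite, whence the
    factor 2.\<close>
  have q_eq: "q x = e x - 2 * (\<Sum>r\<in>S. C r * x r * (\<Sum>s\<in>S. A r s * x s))" for x
  proof -
    have "q x = (\<Sum>s\<in>S. (\<Sum>r\<in>S. A r s * x r)\<^sup>2)"
      unfolding q_def by (intro sum.cong refl) (simp add: skew_sum)
    also have "\<dots> = (\<Sum>s\<in>S. \<Sum>r\<in>S. \<Sum>t\<in>S. x r * (A r s * A t s) * x t)"
      by (simp add: power2_eq_square sum_product mult_ac)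
    also have "\<dots> = (\<Sum>r\<in>S. \<Sum>t\<in>S. \<Sum>s\<in>S. x r * (A r s * A t s) * x t)"
      by (subst sum.swap) (intro sum.cong refl sum.swap)
    also have "\<dots> = (\<Sum>r\<in>S. \<Sum>t\<in>S. x r * (E r t + A r t * (C t - C r)) * x t)"
      by (intro sum.cong refl) (simp add: comm[symmetric] sum_distrib_left sum_distrib_right)
    also have "\<dots> = e x + (\<Sum>r\<in>S. \<Sum>t\<in>S. x r * A r t * C t * x t)
        - (\<Sum>r\<in>S. \<Sum>t\<in>S. x r * A r t * C r * x t)"
      by (simp add: e_def algebra_simps sum.distrib sum_subtractf)
    also have "(\<Sum>r\<in>S. \<Sum>t\<in>S. x r * A r t * C t * x t)
        = - (\<Sum>r\<in>S. \<Sum>t\<in>S. x r * A r t * C r * x t)"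
    proof (subst sum.swap, unfold sum_negf[symmetric], intro sum.cong refl)
      fix r t assume "r \<in> S" "t \<in> S"
      from skew[OF this] show "x t * A t r * C r * x r = - (x r * A r t * C r * x t)" by simp
    qed
    also have "(\<Sum>r\<in>S. \<Sum>t\<in>S. x r * A r t * C r * x t)
        = (\<Sum>r\<in>S. C r * x r * (\<Sum>s\<in>S. A r s * x s))"
      by (simp add: sum_distrib_left mult_ac)
    finally show ?thesis by simp
  qed
  define v where "v = (\<lambda>r. \<Sum>s\<in>S. A r s * u s)"
  define w where "w = (\<lambda>r. \<Sum>s\<in>S. A r s * v s)"
  define mu where "mu = q u"
  have nv: "nrm v = mu" by (simp add: nrm_def v_def mu_def q_def)
  have qv: "q v = nrm w" by (simp add: nrm_def w_def q_def)
  have mu0: "mu \<ge> 0" unfolding mu_def q_def by (simp add: sum_nonneg)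
  have uw: "(\<Sum>r\<in>S. u r * w r) = - mu"
  proof -
    have "(\<Sum>r\<in>S. u r * w r) = (\<Sum>s\<in>S. v s * (\<Sum>r\<in>S. A r s * u r))"
      unfolding w_def sum_distrib_left by (subst sum.swap) (simp add: mult_ac)
    also have "\<dots> = (\<Sum>s\<in>S. - (v s)\<^sup>2)"
      by (intro sum.cong refl) (simp add: skew_sum v_def power2_eq_square)
    finally show ?thesis using nv by (simp add: sum_negf nrm_def)
  qed
  \<comment> \<open>\<open>A\<^sup>2 u + \<mu> u\<close> has norm at most \<open>0\<close>, by maximality of \<open>u\<close> applied to \<open>A u\<close>.\<close>
  have "nrm (\<lambda>r. w r + mu * u r) = nrm w + 2 * mu * (\<Sum>r\<in>S. u r * w r) + mu\<^sup>2 * nrm u"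
    by (simp add: nrm_def power2_eq_square algebra_simps sum.distrib sum_distrib_left)
  also have "\<dots> \<le> 0" using umax[of v] uw u1 qv nv by (simp add: mu_def power2_eq_square)
  finally have "nrm (\<lambda>r. w r + mu * u r) = 0"
    by (simp add: nrm_def sum_nonneg antisym)
  then have w: "w r = - mu * u r" if "r \<in> S" for r
    using that fin by (simp add: nrm_def sum_nonneg_eq_0_iff eq_neg_iff_add_eq_0)
  define X where "X = (\<Sum>r\<in>S. C r * u r * v r)"
  have 1: "mu = e u - 2 * X" unfolding mu_def X_def by (subst q_eq) (simp add: v_def)
  have "nrm w = mu\<^sup>2 * nrm u"
    by (simp add: nrm_def w power_mult_distrib sum_distrib_left)
  moreover have "(\<Sum>r\<in>S. C r * v r * w r) = - mu * X"
    by (simp add: w X_def sum_distrib_left mult_ac flip: sum_negf)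
  moreover have "nrm w = e v - 2 * (\<Sum>r\<in>S. C r * v r * w r)"
    using q_eq[of v] unfolding qv w_def .
  ultimately have 2: "mu\<^sup>2 = e v + 2 * mu * X"
    using u1 by simp
  have "e u \<le> M" "e v \<le> M * mu" using bound[of u] bound[of v] u1 nv by (simp_all add: e_def nrm_def)
  \<comment> \<open>Multiplying by \<open>mu\<close> matches the coefficient of \<open>X\<close> in
    the identity for \<open>v\<close>, so that \<open>X\<close> drops out of the sum.\<close>
  moreover have "mu * mu = mu * e u - 2 * mu * X" 
    using arg_cong[OF 1, of "\<lambda>t. mu * t"] by (simp add: algebra_simps)
  ultimately have "mu * mu + mu * mu \<le> mu * M + M * mu"
    using 2 mult_left_mono[of "e u" M mu] mu0 by (simp add: power2_eq_square mult.commute)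
  then have "mu \<le> M" using mu0 M by (cases "mu = 0") auto
  then have "mu * nrm x \<le> M * nrm x"
    by (intro mult_right_mono) (auto simp: nrm_def sum_nonneg)
  then show ?thesis using umax[of x] by (simp add: mu_def q_def nrm_def)
qed simp

section \<open>Spaced points on the circle\<close>

text \<open>Square y cos y \<le> sin y and replace cos^2 by 1 - sin^2. The additive 1 only costs a
  term of order 1/\<delta> when summed over spaced points.\<close>

lemma inverse_sin_squared_le:
  fixes x :: real
  assumes "x \<noteq> 0" "\<bar>x\<bar> \<le> pi / 2"
  shows "1 / (sin x)\<^sup>2 \<le> 1 + 1 / x\<^sup>2"
proof -
  \<comment> \<open>The difference sin y - y cos y vanishes at 0 and has derivative y sin y.\<close>
  have *: "y * cos y \<le> sin y" if "0 \<le> y" "y \<le> pi / 2" for y :: real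
  proof -
    have "sin 0 - 0 * cos 0 \<le> sin y - y * cos y"
    proof (rule DERIV_nonneg_imp_nondecreasing[OF that(1)])
      fix t assume t: "0 \<le> t" "t \<le> y"
      have "((\<lambda>t. sin t - t * cos t) has_real_derivative t * sin t) (at t)"
        by (auto intro!: derivative_eq_intros)
      moreover have "0 \<le> t * sin t" using t that by (intro mult_nonneg_nonneg sin_ge_zero) auto
      ultimately show "\<exists>d. ((\<lambda>t. sin t - t * cos t) has_real_derivative d) (at t) \<and> 0 \<le> d" by blast
    qed
    then show ?thesis by simp
  qed
  define y where "y = \<bar>x\<bar>"
  have y: "0 < y" "y \<le> pi / 2" using assms by (auto simp: y_def)
  have s: "sin y > 0" using y by (intro sin_gt_zero) auto
  have "(y * cos y)\<^sup>2 \<le> (sin y)\<^sup>2"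
    using y *[of y] by (intro power_mono mult_nonneg_nonneg cos_ge_zero) auto
  then have "y\<^sup>2 \<le> (sin y)\<^sup>2 * (1 + y\<^sup>2)"
    by (simp add: power_mult_distrib cos_squared_eq algebra_simps)
  then have "1 / (sin y)\<^sup>2 \<le> 1 + 1 / y\<^sup>2"
    using s y by (simp add: field_simps)
  moreover have "(sin y)\<^sup>2 = (sin x)\<^sup>2" by (simp add: y_def abs_if)
  ultimately show ?thesis by (simp add: y_def)
qed

text \<open>Cut the line into cells of length \<delta>: each holds at most one point, cell 0 is
  empty, and at most 1/(2\<delta>) cells remain. A point in cell k costs at most 1 + 1/(pi \<delta>
  k)^2, and the sum of 1/k^2 is at most pi^2/6.\<close>

lemma spaced_reals_sum_bound:
  fixes y :: "'a \<Rightarrow> real"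
  assumes \<delta>: "0 < \<delta>"
    and range: "\<And>s. s \<in> T \<Longrightarrow> \<delta> \<le> y s \<and> y s \<le> 1 / 2"
    and spaced: "\<And>s t. s \<in> T \<Longrightarrow> t \<in> T \<Longrightarrow> s \<noteq> t \<Longrightarrow> \<delta> \<le> \<bar>y s - y t\<bar>"
  shows "(\<Sum>s\<in>T. 1 + 1 / (pi * y s)\<^sup>2) \<le> 1 / (2 * \<delta>) + 1 / (6 * \<delta>\<^sup>2)"
proof -
  define g where "g s = nat \<lfloor>y s / \<delta>\<rfloor>" for s
  define n where "n = nat \<lfloor>1 / (2 * \<delta>)\<rfloor>"
  have one: "1 \<le> y s / \<delta>" if "s \<in> T" for s using range[OF that] \<delta> by simp
  have g1: "1 \<le> g s" if "s \<in> T" for s using one[OF that] unfolding g_def by linarith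
  have gfl: "real (g s) = of_int \<lfloor>y s / \<delta>\<rfloor>" if "s \<in> T" for s
    using one[OF that] unfolding g_def by simp
  have gle: "\<delta> * real (g s) \<le> y s" if "s \<in> T" for s
  proof -
    have "real (g s) \<le> y s / \<delta>" using gfl[OF that] by linarith
    then show ?thesis using \<delta> by (simp add: field_simps)
  qed
  have gn: "g s \<le> n" if "s \<in> T" for s
  proof -
    have "y s / \<delta> \<le> 1 / (2 * \<delta>)" using range[OF that] \<delta> by (simp add: field_simps)
    then show ?thesis unfolding g_def n_def by (intro nat_mono floor_mono)
  qed
  have inj: "inj_on g T"
  proof (rule inj_onI, rule ccontr)
    fix s t assume st: "s \<in> T" "t \<in> T" "g s = g t" "s \<noteq> t"
    then have "\<lfloor>y s / \<delta>\<rfloor> = \<lfloor>y t / \<delta>\<rfloor>" using gfl by (metis of_int_eq_iff)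
    then have "\<bar>y s / \<delta> - y t / \<delta>\<bar> < 1" by linarith
    then have "\<bar>y s - y t\<bar> < \<delta>" using \<delta>
      by (simp add: diff_divide_distrib[symmetric] abs_divide)
    then show False using spaced[OF st(1,2,4)] by simp
  qed
  have "(\<Sum>s\<in>T. 1 + 1 / (pi * y s)\<^sup>2) \<le> (\<Sum>s\<in>T. 1 + 1 / (pi * (\<delta> * real (g s)))\<^sup>2)"
  proof (intro sum_mono add_left_mono divide_left_mono power_mono mult_left_mono gle)
    fix s assume "s \<in> T"
    then show "0 < (pi * y s)\<^sup>2 * (pi * (\<delta> * real (g s)))\<^sup>2"
      using g1[of s] range[of s] \<delta> by simp
  qed (use \<delta> in auto)
  also have "\<dots> = (\<Sum>k\<in>g ` T. 1 + 1 / (pi * (\<delta> * real k))\<^sup>2)"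
    using inj by (simp add: sum.reindex)
  also have "\<dots> \<le> (\<Sum>k\<in>{1..n}. 1 + 1 / (pi * (\<delta> * real k))\<^sup>2)"
    using g1 gn by (intro sum_mono2) auto
  also have "\<dots> = real n + 1 / (pi\<^sup>2 * \<delta>\<^sup>2) * (\<Sum>k=1..n. 1 / (real k)\<^sup>2)"
    by (simp add: sum.distrib sum_distrib_left power_mult_distrib mult_ac)
  also have "(\<Sum>k=1..n. 1 / (real k)\<^sup>2) = (\<Sum>k<n. 1 / (real k + 1)\<^sup>2)"
    by (rule sum.reindex_bij_witness[of _ Suc "\<lambda>k. k - 1"]) (auto simp: add.commute)
  also have "\<dots> \<le> pi\<^sup>2 / 6"
    using sum_le_suminf[of "\<lambda>k. 1 / (real k + 1)\<^sup>2" "{..<n}"] inverse_squares_sums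
    by (auto simp: sums_iff add.commute)
  also have "real n \<le> 1 / (2 * \<delta>)" using \<delta> unfolding n_def by simp
  finally show ?thesis by (simp add: divide_right_mono mult.commute)
qed

text \<open>Differences are reduced modulo 1 to [-1/2, 1/2], and the two signs are counted
  separately. The leading constant 1/3 matters: the Hilbert inequality uses this bound three times
  and so gets exactly 1/\<delta>^2.\<close>

lemma spaced_inverse_sin_squared_sum:
  fixes \<alpha> :: "'a \<Rightarrow> real"
  assumes fin: "finite S" and r: "r \<in> S" and \<delta>: "0 < \<delta>"
    and spaced: "\<And>s t k. s \<in> S \<Longrightarrow> t \<in> S \<Longrightarrow> s \<noteq> t \<Longrightarrow> \<delta> \<le> \<bar>\<alpha> s - \<alpha> t - of_int k\<bar>"
  shows "(\<Sum>s\<in>S-{r}. 1 / (sin (pi * (\<alpha> r - \<alpha> s)))\<^sup>2) \<le> 1 / (3 * \<delta>\<^sup>2) + 1 / \<delta>"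
proof -
  define y where "y s = (\<alpha> s - \<alpha> r) - of_int (round (\<alpha> s - \<alpha> r))" for s
  have ybd: "\<bar>y s\<bar> \<le> 1 / 2" for s
    using of_int_round_abs_le[of "\<alpha> s - \<alpha> r"] unfolding y_def by linarith
  have yge: "\<delta> \<le> \<bar>y s\<bar>" if "s \<in> S - {r}" for s
    using that r unfolding y_def by (intro spaced) auto
  have ysp: "\<delta> \<le> \<bar>y s - y t\<bar>" if "s \<in> S" "t \<in> S" "s \<noteq> t" for s t
    using spaced[OF that, of "round (\<alpha> s - \<alpha> r) - round (\<alpha> t - \<alpha> r)"]
    unfolding y_def by (simp add: algebra_simps)
  have sin_y: "(sin (pi * (\<alpha> r - \<alpha> s)))\<^sup>2 = (sin (pi * y s))\<^sup>2" for s
  proof -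
    have "pi * (\<alpha> r - \<alpha> s) = - (pi * y s + of_int (round (\<alpha> s - \<alpha> r)) * pi)"
      by (simp add: y_def algebra_simps)
    moreover have "sin (of_int k * pi) = 0" for k :: int by (simp add: sin_zero_iff_int2)
    moreover have "(cos (of_int k * pi))\<^sup>2 = 1" for k :: int
      using calculation(2)[of k] by (simp add: cos_squared_eq)
    ultimately show ?thesis by (simp only: sin_minus sin_add) (simp add: power_mult_distrib)
  qed
  define T1 where "T1 = {s \<in> S - {r}. y s > 0}"
  define T2 where "T2 = {s \<in> S - {r}. y s < 0}"
  have "y s \<noteq> 0" if "s \<in> S - {r}" for s using yge[OF that] \<delta> by auto
  then have un: "S - {r} = T1 \<union> T2" unfolding T1_def T2_def by force
  have "(\<Sum>s\<in>S-{r}. 1 / (sin (pi * (\<alpha> r - \<alpha> s)))\<^sup>2) \<le> (\<Sum>s\<in>S-{r}. 1 + 1 / (pi * y s)\<^sup>2)"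
    unfolding sin_y
  proof (intro sum_mono inverse_sin_squared_le)
    fix s assume "s \<in> S - {r}"
    then show "pi * y s \<noteq> 0" using yge[of s] \<delta> by auto
    show "\<bar>pi * y s\<bar> \<le> pi / 2" using ybd[of s] by (simp add: abs_mult)
  qed
  also have "\<dots> = (\<Sum>s\<in>T1. 1 + 1 / (pi * y s)\<^sup>2) + (\<Sum>s\<in>T2. 1 + 1 / (pi * y s)\<^sup>2)"
    unfolding un by (rule sum.union_disjoint) (use fin in \<open>auto simp: T1_def T2_def\<close>)
  also have "(\<Sum>s\<in>T1. 1 + 1 / (pi * y s)\<^sup>2) \<le> 1 / (2 * \<delta>) + 1 / (6 * \<delta>\<^sup>2)"
  proof (intro spaced_reals_sum_bound \<delta>)
    show "\<delta> \<le> y s \<and> y s \<le> 1 / 2" if "s \<in> T1" for s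
      using yge[of s] ybd[of s] that by (auto simp: T1_def)
    show "\<delta> \<le> \<bar>y s - y t\<bar>" if "s \<in> T1" "t \<in> T1" "s \<noteq> t" for s t
      using ysp[of s t] that by (auto simp: T1_def)
  qed
  also have "(\<Sum>s\<in>T2. 1 + 1 / (pi * y s)\<^sup>2) = (\<Sum>s\<in>T2. 1 + 1 / (pi * (- y s))\<^sup>2)"
    by simp
  also have "\<dots> \<le> 1 / (2 * \<delta>) + 1 / (6 * \<delta>\<^sup>2)"
  proof (intro spaced_reals_sum_bound \<delta>)
    show "\<delta> \<le> - y s \<and> - y s \<le> 1 / 2" if "s \<in> T2" for s
      using yge[of s] ybd[of s] that by (auto simp: T2_def)
    show "\<delta> \<le> \<bar>- y s - - y t\<bar>" if "s \<in> T2" "t \<in> T2" "s \<noteq> t" for s t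
      using ysp[of s t] that by (auto simp: T2_def)
  qed
  also have "1 / (2 * \<delta>) + 1 / (6 * \<delta>\<^sup>2) + (1 / (2 * \<delta>) + 1 / (6 * \<delta>\<^sup>2)) = 1 / (3 * \<delta>\<^sup>2) + 1 / \<delta>"
    using \<delta> by (simp add: field_simps)
  finally show ?thesis by simp
qed

section \<open>Hilbert's inequality and its dual large sieve\<close>

lemma sin_pi_times_nonzero:
  fixes \<theta> :: real
  assumes "0 < \<delta>" and "\<And>k. \<delta> \<le> \<bar>\<theta> - of_int k\<bar>"
  shows "sin (pi * \<theta>) \<noteq> 0"
proof
  assume "sin (pi * \<theta>) = 0"
  then obtain k :: int where "pi * \<theta> = of_int k * pi"
    by (auto simp: sin_zero_iff_int2)
  then have "\<theta> = of_int k" by simp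
  then show False using assms(2)[of k] assms(1) by simp
qed

text \<open>The identity csc a csc b = csc (a - b) (cot b - cot a) puts the Gram matrix of
  \<open>A\<close> into the shape required by \<open>skew_matrix_norm_bound\<close>, with
  \<open>C\<close> the row sums of cotangents. The form of \<open>E\<close> costs at most three
  times the row bound \<open>h\<close>: once for the diagonal and twice off it.\<close>

lemma hilbert_inequality_inverse_sin:
  fixes \<alpha> x :: "'a \<Rightarrow> real"
  assumes fin: "finite S" and \<delta>: "0 < \<delta>"
    and spaced: "\<And>s t k. s \<in> S \<Longrightarrow> t \<in> S \<Longrightarrow> s \<noteq> t \<Longrightarrow> \<delta> \<le> \<bar>\<alpha> s - \<alpha> t - of_int k\<bar>"
  shows "(\<Sum>r\<in>S. (\<Sum>s\<in>S. 1 / sin (pi * (\<alpha> r - \<alpha> s)) * x s)\<^sup>2)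
           \<le> (1 / \<delta>\<^sup>2 + 3 / \<delta>) * (\<Sum>r\<in>S. (x r)\<^sup>2)"
proof -
  define A where "A r s = 1 / sin (pi * (\<alpha> r - \<alpha> s))" for r s
  define ct where "ct r s = cot (pi * (\<alpha> r - \<alpha> s))" for r s
  define h where "h r = (\<Sum>s\<in>S. (A r s)\<^sup>2)" for r
  define E where "E r t = (if r = t then h r else 2 * A r t * ct r t)" for r t
  define C where "C t = (\<Sum>s\<in>S. ct t s)" for t
  \<comment> \<open>Since \<open>1 / 0 = 0\<close>, the diagonals of \<open>A\<close> and \<open>ct\<close> vanish.\<close>
  have A0 [simp]: "A r r = 0" and ct0 [simp]: "ct r r = 0" for r
    by (simp_all add: A_def ct_def)
  have A_minus: "A s r = - A r s" for r s
    using sin_minus[of "pi * (\<alpha> r - \<alpha> s)"] by (simp add: A_def algebra_simps)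
  have ct_minus: "ct s r = - ct r s" for r s
    using cot_minus[of "pi * (\<alpha> r - \<alpha> s)"] by (simp add: ct_def algebra_simps)
  have nz: "sin (pi * (\<alpha> r - \<alpha> s)) \<noteq> 0" if "r \<in> S" "s \<in> S" "r \<noteq> s" for r s
    by (rule sin_pi_times_nonzero[OF \<delta> spaced[OF that]])
  have h_le: "h r \<le> 1 / (3 * \<delta>\<^sup>2) + 1 / \<delta>" if "r \<in> S" for r
  proof -
    have "h r = (\<Sum>s\<in>S-{r}. (A r s)\<^sup>2)"
      unfolding h_def using fin that by (subst sum.remove[of _ r]) auto
    then show ?thesis
      using spaced_inverse_sin_squared_sum[OF fin that \<delta> spaced] by (simp add: A_def power_divide)
  qed
  have comm: "(\<Sum>s\<in>S. A r s * A t s) = E r t + A r t * (C t - C r)" if rt: "r \<in> S" "t \<in> S" for r t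
  proof (cases "r = t")
    case True
    then show ?thesis by (simp add: E_def h_def power2_eq_square)
  next
    case False
    \<comment> \<open>At \<open>s = r\<close> and \<open>s = t\<close> the left side vanishes, while
      the cotangent formula with zero diagonal gives \<open>- A r t * ct r t\<close>. The two
      corrections form the off-diagonal part of \<open>E\<close>.\<close>
    have "A r s * A t s = A r t * (ct t s - ct r s)
        + (if s = r then A r t * ct r t else 0) + (if s = t then A r t * ct r t else 0)"
      if s: "s \<in> S" for s
    proof -
      consider "s = r" | "s = t" | "s \<noteq> r" "s \<noteq> t" by blast
      then show ?thesis
      proof cases
        case 1
        then show ?thesis using False ct_minus[of t r] by simp
      next
        case 2
        then show ?thesis using False by simp
      next
        case 3
        define a where "a = pi * (\<alpha> r - \<alpha> s)"
        define b where "b = pi * (\<alpha> t - \<alpha> s)"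
        have ab: "pi * (\<alpha> r - \<alpha> t) = a - b" by (simp add: a_def b_def algebra_simps)
        have "sin a \<noteq> 0" "sin b \<noteq> 0" "sin (a - b) \<noteq> 0"
          using nz[OF rt(1) s] nz[OF rt(2) s] nz[OF rt False] 3 ab by (auto simp: a_def b_def)
        then have "1 / sin a * (1 / sin b) = 1 / sin (a - b) * (cot b - cot a)"
          by (simp add: cot_def field_simps sin_diff)
        then show ?thesis using 3 by (simp add: A_def ct_def ab flip: a_def b_def)
      qed
    qed
    then have "(\<Sum>s\<in>S. A r s * A t s) = (\<Sum>s\<in>S. A r t * (ct t s - ct r s)
        + (if s = r then A r t * ct r t else 0) + (if s = t then A r t * ct r t else 0))"
      by (rule sum.cong[OF refl])
    also have "\<dots> = A r t * (C t - C r) + A r t * ct r t + A r t * ct r t"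
      using fin rt by (simp add: sum.distrib C_def sum_distrib_left right_diff_distrib sum_subtractf)
    finally show ?thesis using False by (simp add: E_def)
  qed
  have bound: "(\<Sum>r\<in>S. \<Sum>t\<in>S. x r * E r t * x t) \<le> (1 / \<delta>\<^sup>2 + 3 / \<delta>) * (\<Sum>r\<in>S. (x r)\<^sup>2)" for x
  proof -
    \<comment> \<open>Off the diagonal, |cot| \<le> |csc| and 2|xy| \<le> x^2 + y^2. Each of the
      three terms sums to the same quantity, the sum of \<open>(x r)\<^sup>2 * h r\<close>.\<close>
    have "x r * E r t * x t \<le> (if t = r then (x r)\<^sup>2 * h r else 0)
        + (x r)\<^sup>2 * (A r t)\<^sup>2 + (x t)\<^sup>2 * (A r t)\<^sup>2" for r t
    proof (cases "r = t")
      case True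
      then show ?thesis by (simp add: E_def power2_eq_square)
    next
      case False
      have Act: "\<bar>A r t * ct r t\<bar> \<le> (A r t)\<^sup>2"
      proof -
        have "ct r t = cos (pi * (\<alpha> r - \<alpha> t)) * A r t" by (simp add: ct_def cot_def A_def)
        then have "\<bar>A r t * ct r t\<bar> = \<bar>cos (pi * (\<alpha> r - \<alpha> t))\<bar> * (A r t)\<^sup>2"
          by (simp add: abs_mult power2_eq_square)
        then show ?thesis by (simp add: mult_left_le_one_le)
      qed
      have "x r * E r t * x t \<le> \<bar>2 * (x r * x t) * (A r t * ct r t)\<bar>"
        using False by (simp add: E_def mult_ac)
      also have "\<dots> = \<bar>2 * (x r * x t)\<bar> * \<bar>A r t * ct r t\<bar>" by (rule abs_mult)
      also have "\<dots> \<le> ((x r)\<^sup>2 + (x t)\<^sup>2) * (A r t)\<^sup>2"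
      proof (rule mult_mono)
        show "\<bar>2 * (x r * x t)\<bar> \<le> (x r)\<^sup>2 + (x t)\<^sup>2"
          using sum_squares_bound[of "\<bar>x r\<bar>" "\<bar>x t\<bar>"] by (simp add: abs_mult)
      qed (use Act in auto)
      finally show ?thesis using False by (simp add: distrib_right)
    qed
    then have "(\<Sum>r\<in>S. \<Sum>t\<in>S. x r * E r t * x t) \<le> (\<Sum>r\<in>S. \<Sum>t\<in>S.
        (if t = r then (x r)\<^sup>2 * h r else 0) + (x r)\<^sup>2 * (A r t)\<^sup>2 + (x t)\<^sup>2 * (A r t)\<^sup>2)"
      by (intro sum_mono)
    also have "\<dots> = (\<Sum>r\<in>S. (x r)\<^sup>2 * h r) + (\<Sum>r\<in>S. (x r)\<^sup>2 * h r)
        + (\<Sum>r\<in>S. \<Sum>t\<in>S. (x t)\<^sup>2 * (A r t)\<^sup>2)"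
      using fin by (simp add: sum.distrib h_def sum_distrib_left)
    also have "(\<Sum>r\<in>S. \<Sum>t\<in>S. (x t)\<^sup>2 * (A r t)\<^sup>2) = (\<Sum>r\<in>S. (x r)\<^sup>2 * h r)"
    proof -
      have "(A r t)\<^sup>2 = (A t r)\<^sup>2" for r t using A_minus[of r t] by simp
      then show ?thesis
        by (subst sum.swap) (simp add: h_def sum_distrib_left)
    qed
    also have "(\<Sum>r\<in>S. (x r)\<^sup>2 * h r) \<le> (\<Sum>r\<in>S. (x r)\<^sup>2 * (1 / (3 * \<delta>\<^sup>2) + 1 / \<delta>))"
      by (intro sum_mono mult_left_mono h_le) auto
    also have "\<dots> = (1 / (3 * \<delta>\<^sup>2) + 1 / \<delta>) * (\<Sum>r\<in>S. (x r)\<^sup>2)"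
      by (simp add: sum_distrib_right mult.commute)
    finally show ?thesis by (simp add: algebra_simps)
  qed
  show ?thesis
    using skew_matrix_norm_bound[OF fin A_minus comm bound, of x] \<delta> by (simp add: A_def)
qed

section \<open>Dirichlet kernels and duality\<close>

text \<open>Telescoping through 2 cos a sin \<phi> = sin (a + \<phi>) - sin (a - \<phi>). The
  frequencies are centred at 0, which keeps the kernel real.\<close>

lemma dirichlet_kernel:
  fixes \<phi> :: real
  shows "(\<Sum>k<N. cos ((2 * real k - real N + 1) * \<phi>)) * sin \<phi> = sin (real N * \<phi>)"
proof -
  have "2 * (cos ((2 * real k - real N + 1) * \<phi>) * sin \<phi>)
      = sin ((2 * real (Suc k) - real N) * \<phi>) - sin ((2 * real k - real N) * \<phi>)" for k
  proof -
    define a where "a = (2 * real k - real N + 1) * \<phi>"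
    have "(2 * real (Suc k) - real N) * \<phi> = a + \<phi>" "(2 * real k - real N) * \<phi> = a - \<phi>"
      by (simp_all add: a_def algebra_simps)
    then show ?thesis by (simp add: sin_add sin_diff flip: a_def)
  qed
  then have "2 * ((\<Sum>k<N. cos ((2 * real k - real N + 1) * \<phi>)) * sin \<phi>)
      = sin ((2 * real N - real N) * \<phi>) - sin ((2 * real 0 - real N) * \<phi>)"
    unfolding sum_distrib_left sum_distrib_right
    using sum_lessThan_telescope[of "\<lambda>k. sin ((2 * real k - real N) * \<phi>)" N] by simp
  then show ?thesis by simp
qed

text \<open>Reversing the order of summation negates every frequency.\<close>

lemma conjugate_dirichlet_kernel:
  fixes \<phi> :: real
  shows "(\<Sum>k<N. sin ((2 * real k - real N + 1) * \<phi>)) = 0"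
proof -
  have "(\<Sum>k<N. sin ((2 * real k - real N + 1) * \<phi>))
      = (\<Sum>k<N. sin ((2 * real (N - Suc k) - real N + 1) * \<phi>))"
    by (rule sum.nat_diff_reindex[symmetric])
  also have "\<dots> = (\<Sum>k<N. - sin ((2 * real k - real N + 1) * \<phi>))"
  proof (intro sum.cong refl)
    fix k assume "k \<in> {..<N}"
    then have "(2 * real (N - Suc k) - real N + 1) * \<phi> = - ((2 * real k - real N + 1) * \<phi>)"
      by (simp add: of_nat_diff algebra_simps)
    then show "sin ((2 * real (N - Suc k) - real N + 1) * \<phi>) = - sin ((2 * real k - real N + 1) * \<phi>)"
      by (simp only: sin_minus)
  qed
  finally show ?thesis by (simp add: sum_negf)
qed

text \<open>The kernel cos + sin keeps everything real: a product of two such values is cos (a - b)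
  + sin (a + b), and the second part sums to 0 by centring. What remains is the Dirichlet kernel,
  whose numerator splits by the addition theorem into a skew form in \<open>p\<close> and
  \<open>q\<close> with p^2 + q^2 = c^2, to which Hilbert's inequality applies.\<close>

lemma dual_large_sieve:
  fixes \<alpha> c :: "'a \<Rightarrow> real" and N :: nat
  assumes fin: "finite S" and \<delta>: "0 < \<delta>"
    and spaced: "\<And>s t k. s \<in> S \<Longrightarrow> t \<in> S \<Longrightarrow> s \<noteq> t \<Longrightarrow> \<delta> \<le> \<bar>\<alpha> s - \<alpha> t - of_int k\<bar>"
  defines "V \<equiv> \<lambda>r k. cos ((2 * real k - real N + 1) * (pi * \<alpha> r)) + sin ((2 * real k - real N + 1) * (pi * \<alpha> r))"
  shows "(\<Sum>k<N. (\<Sum>r\<in>S. c r * V r k)\<^sup>2) \<le> (real N + 1 / \<delta> + 3 / 2) * (\<Sum>r\<in>S. (c r)\<^sup>2)"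
proof -
  define A where "A r s = 1 / sin (pi * (\<alpha> r - \<alpha> s))" for r s
  \<comment> \<open>The summand 3/2 completes the square: 1/\<delta>^2 + 3/\<delta> \<le>
    \<open>L\<^sup>2\<close>.\<close>
  define L where "L = 1 / \<delta> + 3 / 2"
  have L: "L > 0" using \<delta> by (simp add: L_def add_pos_pos)
  define sn where "sn r = sin (real N * (pi * \<alpha> r))" for r
  define cs where "cs r = cos (real N * (pi * \<alpha> r))" for r
  have nz: "sin (pi * (\<alpha> r - \<alpha> s)) \<noteq> 0" if "r \<in> S" "s \<in> S" "r \<noteq> s" for r s
    by (rule sin_pi_times_nonzero[OF \<delta> spaced[OF that]])
  have VV: "(\<Sum>k<N. V r k * V s k) = (if s = r then real N else 0) + (sn r * cs s - cs r * sn s) * A r s"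
    if "r \<in> S" "s \<in> S" for r s
  proof -
    have cas: "(cos a + sin a) * (cos b + sin b) = cos (a - b) + sin (a + b)" for a b :: real
      by (simp add: cos_diff sin_add algebra_simps)
    have "(\<Sum>k<N. V r k * V s k) = (\<Sum>k<N. cos ((2 * real k - real N + 1) * (pi * (\<alpha> r - \<alpha> s))))
        + (\<Sum>k<N. sin ((2 * real k - real N + 1) * (pi * (\<alpha> r + \<alpha> s))))"
      unfolding V_def cas sum.distrib[symmetric] by (simp add: algebra_simps)
    also have "\<dots> = (\<Sum>k<N. cos ((2 * real k - real N + 1) * (pi * (\<alpha> r - \<alpha> s))))"
      by (simp only: conjugate_dirichlet_kernel add_0_right)
    also have "\<dots> = (if s = r then real N else 0) + sin (real N * (pi * (\<alpha> r - \<alpha> s))) * A r s"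
      using dirichlet_kernel[of N "pi * (\<alpha> r - \<alpha> s)"] nz[OF that] 
      by (cases "r = s") (auto simp: A_def field_simps)
    also have "sin (real N * (pi * (\<alpha> r - \<alpha> s))) = sn r * cs s - cs r * sn s"
      by (simp add: sn_def cs_def right_diff_distrib sin_diff)
    finally show ?thesis .
  qed
  define p where "p r = c r * sn r" for r
  define q where "q r = c r * cs r" for r
  define Aq where "Aq r = (\<Sum>s\<in>S. A r s * q s)" for r
  have A_minus: "A s r = - A r s" for r s
    using sin_minus[of "pi * (\<alpha> r - \<alpha> s)"] by (simp add: A_def algebra_simps)
  have "(\<Sum>k<N. (\<Sum>r\<in>S. c r * V r k)\<^sup>2) = (\<Sum>k<N. \<Sum>r\<in>S. \<Sum>s\<in>S. c r * c s * (V r k * V s k))"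
    by (simp add: power2_eq_square sum_product mult_ac)
  also have "\<dots> = (\<Sum>r\<in>S. \<Sum>s\<in>S. c r * c s * (\<Sum>k<N. V r k * V s k))"
    unfolding sum_distrib_left by (subst sum.swap) (intro sum.cong refl sum.swap)
  also have "\<dots> = (\<Sum>r\<in>S. \<Sum>s\<in>S. (if s = r then real N * (c r)\<^sup>2 else 0) + p r * A r s * q s - q r * A r s * p s)"
    by (intro sum.cong refl) (simp add: VV p_def q_def power2_eq_square algebra_simps)
  also have "\<dots> = real N * (\<Sum>r\<in>S. (c r)\<^sup>2) + (\<Sum>r\<in>S. \<Sum>s\<in>S. p r * A r s * q s)
      - (\<Sum>r\<in>S. \<Sum>s\<in>S. q r * A r s * p s)"
    using fin by (simp add: sum.distrib sum_subtractf sum_distrib_left)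
  \<comment> \<open>Exchanging \<open>r\<close> and \<open>s\<close> and using skewness turns the
    second form into minus the first, so the difference doubles it.\<close>
  also have "(\<Sum>r\<in>S. \<Sum>s\<in>S. q r * A r s * p s) = (\<Sum>r\<in>S. \<Sum>s\<in>S. - (p r * A r s * q s))"
  proof (subst sum.swap, intro sum.cong refl)
    fix r s
    show "q s * A s r * p r = - (p r * A r s * q s)" using A_minus[of s r] by simp
  qed
  also have "\<dots> = - (\<Sum>r\<in>S. \<Sum>s\<in>S. p r * A r s * q s)" by (simp add: sum_negf)
  also have "(\<Sum>r\<in>S. \<Sum>s\<in>S. p r * A r s * q s) = (\<Sum>r\<in>S. p r * Aq r)"
    by (simp add: Aq_def sum_distrib_left mult_ac)
  finally have eq: "(\<Sum>k<N. (\<Sum>r\<in>S. c r * V r k)\<^sup>2)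
      = real N * (\<Sum>r\<in>S. (c r)\<^sup>2) + (\<Sum>r\<in>S. 2 * p r * Aq r)"
    by (simp add: sum_distrib_left mult_ac)
  \<comment> \<open>The weight \<open>L\<close> balances the two squares: after the norm bound for
    \<open>Aq\<close>, both \<open>p\<close> and \<open>q\<close> carry the factor \<open>L\<close>
    and recombine into \<open>c\<close>.\<close>
  have "(\<Sum>r\<in>S. 2 * p r * Aq r) \<le> (\<Sum>r\<in>S. L * (p r)\<^sup>2 + (Aq r)\<^sup>2 / L)"
  proof (intro sum_mono)
    fix r
    have "0 \<le> (L * p r - Aq r)\<^sup>2 / L" using L by simp
    also have "\<dots> = L * (p r)\<^sup>2 + (Aq r)\<^sup>2 / L - 2 * p r * Aq r"
      using L by (simp add: power2_eq_square field_simps)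
    finally show "2 * p r * Aq r \<le> L * (p r)\<^sup>2 + (Aq r)\<^sup>2 / L" by simp
  qed
  also have "\<dots> = L * (\<Sum>r\<in>S. (p r)\<^sup>2) + (\<Sum>r\<in>S. (Aq r)\<^sup>2) / L"
    by (simp add: sum.distrib sum_distrib_left sum_divide_distrib)
  also have "(\<Sum>r\<in>S. (Aq r)\<^sup>2) \<le> L\<^sup>2 * (\<Sum>r\<in>S. (q r)\<^sup>2)"
  proof -
    have "(\<Sum>r\<in>S. (Aq r)\<^sup>2) \<le> (1 / \<delta>\<^sup>2 + 3 / \<delta>) * (\<Sum>r\<in>S. (q r)\<^sup>2)"
      unfolding Aq_def A_def by (rule hilbert_inequality_inverse_sin[OF fin \<delta> spaced])
    also have "\<dots> \<le> L\<^sup>2 * (\<Sum>r\<in>S. (q r)\<^sup>2)"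
    proof (rule mult_right_mono)
      show "1 / \<delta>\<^sup>2 + 3 / \<delta> \<le> L\<^sup>2" by (simp add: L_def power2_sum power_divide)
    qed (simp add: sum_nonneg)
    finally show ?thesis .
  qed
  also have "L\<^sup>2 * (\<Sum>r\<in>S. (q r)\<^sup>2) / L = L * (\<Sum>r\<in>S. (q r)\<^sup>2)"
    using L by (simp add: power2_eq_square)
  also have "L * (\<Sum>r\<in>S. (p r)\<^sup>2) + L * (\<Sum>r\<in>S. (q r)\<^sup>2) = L * (\<Sum>r\<in>S. (c r)\<^sup>2)"
  proof -
    have "(p r)\<^sup>2 + (q r)\<^sup>2 = (c r)\<^sup>2" for r
      by (simp add: p_def q_def sn_def cs_def power_mult_distrib flip: distrib_left)
    then show ?thesis by (simp flip: distrib_left sum.distrib)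
  qed
  finally have "(\<Sum>r\<in>S. 2 * p r * Aq r) \<le> L * (\<Sum>r\<in>S. (c r)\<^sup>2)"
    using L by (simp add: divide_right_mono)
  then show ?thesis unfolding eq by (simp add: L_def algebra_simps)
qed

text \<open>A matrix and its transpose have the same norm. With y the image of x under V^T V,
  expanding |\<Delta> x - y|^2 \<ge> 0 and using the dual bound |y|^2 \<le> \<Delta> T gives the
  claim.\<close>

lemma duality_principle:
  fixes V :: "'a \<Rightarrow> 'b \<Rightarrow> real"
  assumes \<Delta>: "0 < \<Delta>"
    and dual: "\<And>c. (\<Sum>n\<in>Z. (\<Sum>r\<in>S. c r * V r n)\<^sup>2) \<le> \<Delta> * (\<Sum>r\<in>S. (c r)\<^sup>2)"
  shows "(\<Sum>r\<in>S. (\<Sum>n\<in>Z. V r n * x n)\<^sup>2) \<le> \<Delta> * (\<Sum>n\<in>Z. (x n)\<^sup>2)"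
proof -
  define c where "c r = (\<Sum>n\<in>Z. V r n * x n)" for r
  define y where "y n = (\<Sum>r\<in>S. c r * V r n)" for n
  define T where "T = (\<Sum>r\<in>S. (c r)\<^sup>2)"
  have T: "T = (\<Sum>n\<in>Z. x n * y n)"
  proof -
    have "T = (\<Sum>r\<in>S. \<Sum>n\<in>Z. c r * (V r n * x n))"
      unfolding T_def power2_eq_square sum_distrib_left[symmetric] by (simp add: c_def)
    also have "\<dots> = (\<Sum>n\<in>Z. x n * y n)"
      by (subst sum.swap) (simp add: y_def sum_distrib_left mult_ac)
    finally show ?thesis .
  qed
  have "0 \<le> (\<Sum>n\<in>Z. (\<Delta> * x n - y n)\<^sup>2)" by (simp add: sum_nonneg)
  also have "\<dots> = \<Delta>\<^sup>2 * (\<Sum>n\<in>Z. (x n)\<^sup>2) - 2 * \<Delta> * T + (\<Sum>n\<in>Z. (y n)\<^sup>2)"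
    unfolding T
    by (simp add: power2_diff power_mult_distrib sum.distrib sum_subtractf sum_distrib_left mult_ac)
  also have "(\<Sum>n\<in>Z. (y n)\<^sup>2) \<le> \<Delta> * T" unfolding y_def T_def by (rule dual)
  finally have "\<Delta> * T \<le> \<Delta> * (\<Delta> * (\<Sum>n\<in>Z. (x n)\<^sup>2))" by (simp add: power2_eq_square mult_ac)
  then show ?thesis using \<Delta> by (simp add: T_def c_def)
qed

section \<open>The large sieve\<close>

text \<open>The dual inequality is transposed for the frequencies \<alpha> and for their negatives.
  The constant exceeds the sharp one by 5/2. Allowing a subset \<open>Z\<close> of the interval
  makes room for dilated intervals.\<close>

lemma large_sieve_weak:
  fixes \<alpha> :: "'a \<Rightarrow> real" and x :: "int \<Rightarrow> real"
  assumes fin: "finite S" and \<delta>: "0 < \<delta>"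
    and spaced: "\<And>s t k. s \<in> S \<Longrightarrow> t \<in> S \<Longrightarrow> s \<noteq> t \<Longrightarrow> \<delta> \<le> \<bar>\<alpha> s - \<alpha> t - of_int k\<bar>"
    and Z: "Z \<subseteq> {m..<m + int N}"
  shows "(\<Sum>i\<in>Z. \<Sum>j\<in>Z. x i * (\<Sum>r\<in>S. cos (2 * pi * \<alpha> r * of_int (i - j))) * x j)
           \<le> (real N + 1 / \<delta> + 3 / 2) * (\<Sum>i\<in>Z. (x i)\<^sup>2)"
proof -
  define \<Delta> where "\<Delta> = real N + 1 / \<delta> + 3 / 2"
  define X where "X = (\<Sum>i\<in>Z. (x i)\<^sup>2)"
  \<comment> \<open>Phases are measured from the midpoint of the interval to match the centred
    kernels; only their differences enter the form.\<close>
  define \<theta> where "\<theta> r n = (2 * of_int n - 2 * of_int m - real N + 1) * (pi * \<alpha> r)" for r and n :: int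
  have \<Delta>: "\<Delta> > 0" using \<delta> by (simp add: \<Delta>_def add_nonneg_pos)
  have sieve: "(\<Sum>r\<in>S. (\<Sum>n\<in>Z. (cos (\<theta> r n) + \<epsilon> * sin (\<theta> r n)) * x n)\<^sup>2) \<le> \<Delta> * X"
    if \<epsilon>: "\<epsilon> = 1 \<or> \<epsilon> = -1" for \<epsilon> :: real
    unfolding X_def
  proof (rule duality_principle[OF \<Delta>])
    fix c
    define W where "W r k = cos ((2 * real k - real N + 1) * (pi * (\<epsilon> * \<alpha> r)))
      + sin ((2 * real k - real N + 1) * (pi * (\<epsilon> * \<alpha> r)))" for r k
    have "\<delta> \<le> \<bar>\<epsilon> * \<alpha> s - \<epsilon> * \<alpha> t - of_int k\<bar>" if "s \<in> S" "t \<in> S" "s \<noteq> t" for s t k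
      using spaced[OF that, of k] spaced[OF that, of "- k"] \<epsilon> by auto
    note dual = dual_large_sieve[OF fin \<delta> this, where N = N and c = c]
    have "(\<Sum>n\<in>Z. (\<Sum>r\<in>S. c r * (cos (\<theta> r n) + \<epsilon> * sin (\<theta> r n)))\<^sup>2)
        \<le> (\<Sum>n\<in>{m..<m + int N}. (\<Sum>r\<in>S. c r * (cos (\<theta> r n) + \<epsilon> * sin (\<theta> r n)))\<^sup>2)"
      using Z by (intro sum_mono2) auto
    also have "\<dots> = (\<Sum>k<N. (\<Sum>r\<in>S. c r * W r k)\<^sup>2)"
    proof (rule sum.reindex_bij_witness[of _ "\<lambda>k. m + int k" "\<lambda>n. nat (n - m)"])
      fix n assume n: "n \<in> {m..<m + int N}"
      have "W r (nat (n - m)) = cos (\<theta> r n) + \<epsilon> * sin (\<theta> r n)" for r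
      proof -
        have "(2 * real (nat (n - m)) - real N + 1) * (pi * (\<epsilon> * \<alpha> r)) = \<epsilon> * \<theta> r n"
          using n by (simp add: \<theta>_def algebra_simps)
        then show ?thesis using \<epsilon> unfolding W_def by auto
      qed
      then show "(\<Sum>r\<in>S. c r * W r (nat (n - m)))\<^sup>2 =
          (\<Sum>r\<in>S. c r * (cos (\<theta> r n) + \<epsilon> * sin (\<theta> r n)))\<^sup>2" by simp
    qed auto
    also have "\<dots> \<le> \<Delta> * (\<Sum>r\<in>S. (c r)\<^sup>2)" using dual by (simp add: W_def \<Delta>_def)
    finally show "(\<Sum>n\<in>Z. (\<Sum>r\<in>S. c r * (cos (\<theta> r n) + \<epsilon> * sin (\<theta> r n)))\<^sup>2)
        \<le> \<Delta> * (\<Sum>r\<in>S. (c r)\<^sup>2)" .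
  qed
  \<comment> \<open>The kernel is \<open>cos (a - b) \<plusminus> sin (a + b)\<close>; averaging over the sign of the frequencies
    removes the sine.\<close>
  have sq: "(\<Sum>n\<in>Z. (cos (\<theta> r n) + 1 * sin (\<theta> r n)) * x n)\<^sup>2
      + (\<Sum>n\<in>Z. (cos (\<theta> r n) + (-1) * sin (\<theta> r n)) * x n)\<^sup>2
      = 2 * (\<Sum>i\<in>Z. \<Sum>j\<in>Z. x i * cos (2 * pi * \<alpha> r * of_int (i - j)) * x j)" for r
  proof -
    have "2 * (x i * cos (2 * pi * \<alpha> r * of_int (i - j)) * x j)
        = (cos (\<theta> r i) + 1 * sin (\<theta> r i)) * x i * ((cos (\<theta> r j) + 1 * sin (\<theta> r j)) * x j)
        + (cos (\<theta> r i) + (-1) * sin (\<theta> r i)) * x i * ((cos (\<theta> r j) + (-1) * sin (\<theta> r j)) * x j)" for i j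
    proof -
      have "2 * pi * \<alpha> r * of_int (i - j) = \<theta> r i - \<theta> r j" by (simp add: \<theta>_def algebra_simps)
      then show ?thesis by (simp only: cos_diff) (simp add: algebra_simps)
    qed
    then show ?thesis
      by (simp only: power2_eq_square sum_product sum.distrib[symmetric]) (simp only: sum_distrib_left)
  qed
  have "2 * (\<Sum>i\<in>Z. \<Sum>j\<in>Z. x i * (\<Sum>r\<in>S. cos (2 * pi * \<alpha> r * of_int (i - j))) * x j)
      = (\<Sum>r\<in>S. 2 * (\<Sum>i\<in>Z. \<Sum>j\<in>Z. x i * cos (2 * pi * \<alpha> r * of_int (i - j)) * x j))"
  proof -
    have "(\<Sum>i\<in>Z. \<Sum>j\<in>Z. x i * (\<Sum>r\<in>S. cos (2 * pi * \<alpha> r * of_int (i - j))) * x j)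
        = (\<Sum>i\<in>Z. \<Sum>j\<in>Z. \<Sum>r\<in>S. x i * cos (2 * pi * \<alpha> r * of_int (i - j)) * x j)"
      by (simp only: sum_distrib_left sum_distrib_right)
    also have "\<dots> = (\<Sum>i\<in>Z. \<Sum>r\<in>S. \<Sum>j\<in>Z. x i * cos (2 * pi * \<alpha> r * of_int (i - j)) * x j)"
      by (intro sum.cong refl sum.swap)
    also have "\<dots> = (\<Sum>r\<in>S. \<Sum>i\<in>Z. \<Sum>j\<in>Z. x i * cos (2 * pi * \<alpha> r * of_int (i - j)) * x j)"
      by (rule sum.swap)
    finally show ?thesis by (simp only: sum_distrib_left)
  qed
  also have "\<dots> \<le> \<Delta> * X + \<Delta> * X"
    unfolding sq[symmetric] sum.distrib by (intro add_mono sieve) auto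
  finally show ?thesis by (simp add: \<Delta>_def X_def mult.commute)
qed

text \<open>Replacing the frequencies \<open>\<alpha>\<close> by \<open>(\<alpha> + k) / K\<close> and the interval by its \<open>K\<close>-fold dilate
  multiplies both sides by \<open>K\<close> up to a bounded error; letting \<open>K \<rightarrow> \<infinity>\<close> gives the sharp constant
  (an argument of P. Cohen).\<close>

theorem large_sieve:
  fixes \<alpha> :: "'a \<Rightarrow> real" and x :: "int \<Rightarrow> real"
  assumes fin: "finite S" and \<delta>: "0 < \<delta>" "\<delta> \<le> 1" and N: "N \<ge> 1"
    and spaced: "\<And>s t k. s \<in> S \<Longrightarrow> t \<in> S \<Longrightarrow> s \<noteq> t \<Longrightarrow> \<delta> \<le> \<bar>\<alpha> s - \<alpha> t - of_int k\<bar>"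
    and Z: "Z \<subseteq> {m..<m + int N}"
  shows "(\<Sum>i\<in>Z. \<Sum>j\<in>Z. x i * (\<Sum>r\<in>S. cos (2 * pi * \<alpha> r * of_int (i - j))) * x j)
           \<le> (real N + 1 / \<delta> - 1) * (\<Sum>i\<in>Z. (x i)\<^sup>2)"
proof -
  define Q where "Q = (\<Sum>i\<in>Z. \<Sum>j\<in>Z. x i * (\<Sum>r\<in>S. cos (2 * pi * \<alpha> r * of_int (i - j))) * x j)"
  define X where "X = (\<Sum>i\<in>Z. (x i)\<^sup>2)"
  have scaled: "real K * Q \<le> real K * ((real N + 1 / \<delta> - 1) * X) + 5 / 2 * X" if K: "K > 0" for K
  proof -
    define S' where "S' = S \<times> {..<K}"
    define \<beta> where "\<beta> rk = (\<alpha> (fst rk) + real (snd rk)) / real K" for rk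
    define Z' where "Z' = (\<lambda>i. int K * i) ` Z"
    \<comment> \<open>Division by \<open>K\<close> undoes the dilation on multiples of
      \<open>K\<close>, and \<open>Z'\<close> contains nothing else.\<close>
    define x' where "x' j = x (j div int K)" for j
    have inj: "inj_on (\<lambda>i. int K * i) Z" using K by (auto simp: inj_on_def)
    have sp: "\<delta> / real K \<le> \<bar>\<beta> s - \<beta> t - of_int j\<bar>" if st: "s \<in> S'" "t \<in> S'" "s \<noteq> t" for s t j
    proof -
      obtain r k where s: "s = (r, k)" by (cases s)
      obtain r' k' where t: "t = (r', k')" by (cases t)
      define n where "n = j * int K + int k' - int k"
      have eq: "\<beta> s - \<beta> t - of_int j = (\<alpha> r - \<alpha> r' - of_int n) / real K"
        using K by (simp add: \<beta>_def s t n_def field_simps)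
      have "\<delta> \<le> \<bar>\<alpha> r - \<alpha> r' - of_int n\<bar>"
      proof (cases "r = r'")
        case False
        then show ?thesis using st s t by (intro spaced) (auto simp: S'_def)
      next
        \<comment> \<open>Copies of one frequency differ by k/K with k not divisible by K; their
          spacing is at least 1/K, which suffices because \<delta> \<le> 1.\<close>
        case True
        then have kk: "k \<noteq> k'" "k < K" "k' < K" using st s t by (auto simp: S'_def)
        have "n \<noteq> 0"
        proof
          assume "n = 0"
          then have "int k = j * int K + int k'" by (simp add: n_def)
          then have "int k mod int K = int k' mod int K" by simp
          then show False using kk by simp
        qed
        then have "1 \<le> \<bar>of_int n :: real\<bar>" by linarith
        then show ?thesis using True \<delta> by simp
      qed
      then show ?thesis unfolding eq using K by (simp add: abs_divide divide_right_mono)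
    qed
    \<comment> \<open>The dilate of N consecutive integers spans only K(N - 1) + 1 integers; this is
      the source of the -1 in the sharp constant.\<close>
    have "Z' \<subseteq> {int K * m..<int K * m + int (K * (N - 1) + 1)}"
    proof -
      have "int K * i \<in> {int K * m..<int K * m + int (K * (N - 1) + 1)}" if "i \<in> Z" for i
      proof -
        have i: "m \<le> i" "i \<le> m + int (N - 1)" using that Z N by auto
        from i have "int K * m \<le> int K * i" by (simp add: mult_left_mono)
        moreover have "int K * i \<le> int K * (m + int (N - 1))" using i by (intro mult_left_mono) auto
        ultimately show ?thesis by (simp add: distrib_left)
      qed
      then show ?thesis by (auto simp: Z'_def)
    qed
    moreover have "finite S'" using fin by (simp add: S'_def)
    moreover have "0 < \<delta> / real K" using \<delta> K by simp
    ultimately have "(\<Sum>i\<in>Z'. \<Sum>j\<in>Z'. x' i * (\<Sum>r\<in>S'. cos (2 * pi * \<beta> r * of_int (i - j))) * x' j)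
           \<le> (real (K * (N - 1) + 1) + 1 / (\<delta> / real K) + 3 / 2) * (\<Sum>i\<in>Z'. (x' i)\<^sup>2)"
      using sp by (intro large_sieve_weak) auto
    also have "(\<Sum>i\<in>Z'. (x' i)\<^sup>2) = X"
      unfolding Z'_def X_def using K by (simp add: sum.reindex[OF inj] x'_def)
    also have "(\<Sum>i\<in>Z'. \<Sum>j\<in>Z'. x' i * (\<Sum>r\<in>S'. cos (2 * pi * \<beta> r * of_int (i - j))) * x' j)
        = (\<Sum>i\<in>Z. \<Sum>j\<in>Z. x i * (\<Sum>r\<in>S'. cos (2 * pi * \<beta> r * of_int (int K * i - int K * j))) * x j)"
      unfolding Z'_def using K by (simp add: sum.reindex[OF inj] x'_def)
    also have "\<dots> = real K * Q"
    proof -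
      have "(\<Sum>r\<in>S'. cos (2 * pi * \<beta> r * of_int (int K * i - int K * j)))
          = real K * (\<Sum>r\<in>S. cos (2 * pi * \<alpha> r * of_int (i - j)))" for i j
      proof -
        \<comment> \<open>On differences that are multiples of \<open>K\<close> the shift by
          \<open>k\<close> adds a multiple of 2 pi, so all \<open>K\<close> copies give the same
          cosine.\<close>
        have "cos (2 * pi * \<beta> (r, k) * of_int (int K * i - int K * j)) = cos (2 * pi * \<alpha> r * of_int (i - j))" for r k
        proof -
          have "2 * pi * \<beta> (r, k) * of_int (int K * i - int K * j)
              = 2 * pi * \<alpha> r * of_int (i - j) + 2 * pi * of_int (int k * (i - j))"
            using K by (simp add: \<beta>_def field_simps)
          then show ?thesis by (simp only: cos_add cos_int_2pin sin_int_2pin)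
        qed
        then show ?thesis unfolding S'_def
          by (simp add: sum.cartesian_product' sum_distrib_left)
      qed
      then show ?thesis by (simp add: Q_def sum_distrib_left mult_ac)
    qed
    also have "(real (K * (N - 1) + 1) + 1 / (\<delta> / real K) + 3 / 2) * X
        = real K * ((real N + 1 / \<delta> - 1) * X) + 5 / 2 * X"
      using N by (simp add: of_nat_diff algebra_simps)
    finally show ?thesis .
  qed
  have "Q \<le> (real N + 1 / \<delta> - 1) * X"
  proof (rule ccontr)
    assume "\<not> ?thesis"
    then have pos: "Q - (real N + 1 / \<delta> - 1) * X > 0" by simp
    obtain K :: nat where K: "5 / 2 * X < real K * (Q - (real N + 1 / \<delta> - 1) * X)"
      using ex_less_of_nat_mult[OF pos] by blast
    moreover have "X \<ge> 0" by (simp add: X_def sum_nonneg)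
    ultimately have "K > 0" by (cases K) auto
    from scaled[OF this] K show False by (simp add: right_diff_distrib)
  qed
  then show ?thesis by (simp add: Q_def X_def)
qed

section \<open>Partial fractions and Ramanujan sums\<close>

lemma prime_factors_prod_primes:
  fixes S :: "nat set"
  assumes "finite S" and "\<And>p. p \<in> S \<Longrightarrow> prime p"
  shows "prime_factors (\<Prod>S) = S"
proof -
  have "prime_factors (prod (\<lambda>p. p) S) = \<Union>((prime_factors \<circ> (\<lambda>p. p)) ` S)"
    using assms by (intro prime_factors_prod) (auto dest: prime_gt_0_nat)
  also have "\<dots> = S" using assms by (auto simp: prime_prime_factors)
  finally show ?thesis by simp
qed

text \<open>Modulo \<open>q\<close> only the summand \<open>p = q\<close> survives, and its cofactor
  is a unit. This drives both the reducedness and the uniqueness of partial fractions.\<close>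

lemma prime_dvd_partial_fraction_numerator_iff:
  fixes F :: "nat set" and c :: "nat \<Rightarrow> int"
  assumes fin: "finite F" and prime: "\<And>p. p \<in> F \<Longrightarrow> prime p" and q: "q \<in> F"
  shows "int q dvd (\<Sum>p\<in>F. c p * int (\<Prod>(F - {p}))) \<longleftrightarrow> int q dvd c q"
proof -
  have "int q dvd (\<Sum>p\<in>F-{q}. c p * int (\<Prod>(F - {p})))"
  proof (intro dvd_sum dvd_mult)
    fix p assume "p \<in> F - {q}"
    then have "q dvd \<Prod>(F - {p})" using fin q by (intro dvd_prodI) auto
    then show "int q dvd int (\<Prod>(F - {p}))" by (simp only: int_dvd_int_iff)
  qed
  moreover have "(\<Sum>p\<in>F. c p * int (\<Prod>(F - {p})))
      = c q * int (\<Prod>(F - {q})) + (\<Sum>p\<in>F-{q}. c p * int (\<Prod>(F - {p})))"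
    using fin q by (rule sum.remove)
  ultimately have "int q dvd (\<Sum>p\<in>F. c p * int (\<Prod>(F - {p})))
      \<longleftrightarrow> int q dvd c q * int (\<Prod>(F - {q}))"
    by (simp only: dvd_add_left_iff)
  also have "\<dots> \<longleftrightarrow> int q dvd c q"
  proof -
    have "\<not> q dvd \<Prod>(F - {q})"
    proof
      assume "q dvd \<Prod>(F - {q})"
      then obtain p where "p \<in> F - {q}" "q dvd p"
        using fin prime[OF q] by (auto simp: prime_dvd_prod_iff)
      then show False using prime q by (metis DiffE primes_dvd_imp_eq singletonI)
    qed
    then have "\<not> int q dvd int (\<Prod>(F - {q}))" by (simp only: int_dvd_int_iff not_False_eq_True)
    then show ?thesis using prime[OF q] by (simp add: prime_dvd_mult_iff del: of_nat_prod)
  qed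
  finally show ?thesis .
qed

lemma partial_fractions_numerator:
  fixes F :: "nat set" and c :: "nat \<Rightarrow> int"
  assumes fin: "finite F" and prime: "\<And>p. p \<in> F \<Longrightarrow> prime p"
  shows "(\<Sum>p\<in>F. of_int (c p) / real p) * real (\<Prod>F) = of_int (\<Sum>p\<in>F. c p * int (\<Prod>(F - {p})))"
proof -
  have "of_int (c p) / real p * real (\<Prod>F) = of_int (c p * int (\<Prod>(F - {p})))" if "p \<in> F" for p
  proof -
    have "\<Prod>F = p * \<Prod>(F - {p})" using fin that by (rule prod.remove)
    then show ?thesis using prime[OF that, THEN prime_gt_0_nat] by (simp del: of_nat_prod)
  qed
  then show ?thesis by (simp add: sum_distrib_right del: of_nat_prod)
qed

text \<open>If the sum is an integer, its numerator over the common denominator is a multiple of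
  \<open>\<Prod>F\<close>, hence of every \<open>q\<close>.\<close>

lemma dvd_of_partial_fractions_in_Ints:
  fixes F :: "nat set" and c :: "nat \<Rightarrow> int"
  assumes fin: "finite F" and prime: "\<And>p. p \<in> F \<Longrightarrow> prime p"
    and int: "(\<Sum>p\<in>F. of_int (c p) / real p) \<in> \<int>" and q: "q \<in> F"
  shows "int q dvd c q"
proof -
  from int obtain k where k: "(\<Sum>p\<in>F. of_int (c p) / real p) = of_int k" by (elim Ints_cases)
  have "real_of_int (\<Sum>p\<in>F. c p * int (\<Prod>(F - {p}))) = of_int (k * int (\<Prod>F))"
    using partial_fractions_numerator[OF fin prime, of c] k by (simp del: of_nat_prod)
  then have "(\<Sum>p\<in>F. c p * int (\<Prod>(F - {p}))) = k * int (\<Prod>F)"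
    by (simp only: of_int_eq_iff)
  moreover have "q dvd \<Prod>F" using fin q by (intro dvd_prodI) auto
  then have "int q dvd int (\<Prod>F)" by (simp only: int_dvd_int_iff)
  ultimately have "int q dvd (\<Sum>p\<in>F. c p * int (\<Prod>(F - {p})))" by simp
  then show ?thesis using prime_dvd_partial_fraction_numerator_iff[OF fin prime q] by blast
qed

section \<open>Exponential expansion of \<open>M_mat\<close>\<close>

text \<open>A full geometric sum over powers of a p-th root of unity, with the term a = 0
  removed.\<close>

lemma sum_cis_nontrivial_residues:
  fixes n :: int
  assumes p: "p > 0"
  shows "(\<Sum>a=1..<p. cis (2 * pi * (real a / real p) * of_int n))
           = of_real (real p * of_bool (int p dvd n) - 1)"
proof -
  define w where "w = cis (2 * pi * of_int n / real p)"
  have pow: "cis (2 * pi * (real a / real p) * of_int n) = w ^ a" for a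
    by (simp add: w_def Complex.DeMoivre algebra_simps)
  have "w ^ p = cis (2 * pi * of_int n)"
    using p by (simp add: w_def Complex.DeMoivre)
  then have wp: "w ^ p = 1" by simp
  have w1: "w = 1 \<longleftrightarrow> int p dvd n"
  proof
    assume "int p dvd n"
    then obtain k where "n = int p * k" by (elim dvdE)
    then have "2 * pi * of_int n / real p = 2 * pi * of_int k" using p by simp
    then show "w = 1" unfolding w_def by (simp only:) simp
  next
    assume "w = 1"
    then have "cos (2 * pi * of_int n / real p) = 1" by (simp add: w_def complex_eq_iff)
    then obtain k :: int where "2 * pi * of_int n / real p = of_int k * 2 * pi"
      by (auto simp: cos_one_2pi_int)
    then have "real_of_int n = of_int (int p * k)" using p by (simp add: field_simps)
    then have "n = int p * k" by (simp only: of_int_eq_iff)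
    then show "int p dvd n" by simp
  qed
  have "(\<Sum>a<p. w ^ a) = of_real (real p * of_bool (int p dvd n))"
  proof (cases "w = 1")
    case True
    then show ?thesis using w1 by simp
  next
    case False
    then show ?thesis using w1 wp geometric_sum[OF False, of p] by simp
  qed
  moreover have "(\<Sum>a<p. w ^ a) = 1 + (\<Sum>a=1..<p. w ^ a)"
    using p by (simp add: lessThan_atLeast0 sum.atLeast_Suc_lessThan)
  ultimately show ?thesis unfolding pow by (simp add: algebra_simps)
qed

lemma prod_cis: "finite F \<Longrightarrow> (\<Prod>p\<in>F. cis (f p)) = cis (\<Sum>p\<in>F. f p)"
  by (induction F rule: finite_induct) (simp_all add: cis_mult)

text \<open>For squarefree \<open>d\<close> these are the units modulo \<open>d\<close> in partial
  fraction coordinates, one nonzero residue for each prime.\<close>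

definition residue_vectors :: "nat \<Rightarrow> (nat \<Rightarrow> nat) set" where
  "residue_vectors d = (\<Pi>\<^sub>E p\<in>prime_factors d. {1..<p})"

definition partial_fraction :: "nat \<Rightarrow> (nat \<Rightarrow> nat) \<Rightarrow> real" where
  "partial_fraction d a = (\<Sum>p\<in>prime_factors d. real (a p) / real p)"

text \<open>Each prime factor is a sum of characters; multiplying out the product over the primes
  adds their phases. Real parts leave the cosines.\<close>

lemma M_mat_eq_sum_cos:
  "M_mat d i j = (\<Sum>a\<in>residue_vectors d. cos (2 * pi * partial_fraction d a * of_int (i - j)))"
proof -
  have "complex_of_real (M_mat d i j)
      = (\<Prod>p\<in>prime_factors d. of_real (real p * of_bool (int p dvd (i - j)) - 1))"
    by (simp add: M_mat_def)
  also have "\<dots> = (\<Prod>p\<in>prime_factors d. \<Sum>a=1..<p. cis (2 * pi * (real a / real p) * of_int (i - j)))"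
  proof (intro prod.cong refl)
    fix p assume "p \<in> prime_factors d"
    then have "p > 0" by (auto simp: in_prime_factors_iff prime_gt_0_nat)
    from sum_cis_nontrivial_residues[OF this, of "i - j"]
    show "complex_of_real (real p * of_bool (int p dvd (i - j)) - 1)
        = (\<Sum>a=1..<p. cis (2 * pi * (real a / real p) * of_int (i - j)))" by (rule sym)
  qed
  also have "\<dots> = (\<Sum>a\<in>residue_vectors d. \<Prod>p\<in>prime_factors d.
      cis (2 * pi * (real (a p) / real p) * of_int (i - j)))"
    unfolding residue_vectors_def by (rule prod_sum_PiE) auto
  also have "\<dots> = (\<Sum>a\<in>residue_vectors d. cis (2 * pi * partial_fraction d a * of_int (i - j)))"
    by (simp add: prod_cis partial_fraction_def sum_distrib_left sum_distrib_right)
  finally have "Re (complex_of_real (M_mat d i j))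
      = Re (\<Sum>a\<in>residue_vectors d. cis (2 * pi * partial_fraction d a * of_int (i - j)))"
    by (rule arg_cong)
  then show ?thesis by simp
qed

text \<open>A prime \<open>q\<close> dividing both numerator and denominator would divide
  \<open>a q\<close>, which lies strictly between 0 and \<open>q\<close>.\<close>

lemma partial_fraction_in_reduced_fractions:
  assumes d: "d \<in> D" "d = \<Prod>(prime_factors d)" and a: "a \<in> residue_vectors d"
  shows "partial_fraction d a \<in> reduced_fractions D"
proof -
  let ?F = "prime_factors d"
  define A where "A = (\<Sum>p\<in>?F. int (a p) * int (\<Prod>(?F - {p})))"
  have prime: "\<And>p. p \<in> ?F \<Longrightarrow> prime p" by (simp add: in_prime_factors_iff)
  have d0: "d \<noteq> 0"
  proof
    assume "d = 0"
    then show False using d(2) by simp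
  qed
  have "partial_fraction d a * real (\<Prod>?F) = of_int A"
    using partial_fractions_numerator[of ?F "\<lambda>p. int (a p)", OF finite_set_mset prime]
    by (simp add: partial_fraction_def A_def del: of_nat_prod)
  then have "partial_fraction d a * real d = of_int A" unfolding d(2)[symmetric] .
  then have "partial_fraction d a = of_int A / of_nat d" using d0 by (simp add: field_simps)
  moreover have "coprime A (int d)"
  proof (rule ccontr)
    assume "\<not> coprime A (int d)"
    then have "\<not> is_unit (gcd A (int d))" by (simp only: is_unit_gcd not_False_eq_True)
    then obtain r where r: "prime r" "r dvd A" "r dvd int d"
      using d0 prime_divisor_exists[of "gcd A (int d)"] by auto
    define q where "q = nat r"
    have rq: "r = int q" using r(1) by (simp add: q_def prime_ge_0_int)
    have q: "q \<in> ?F" using r d0 unfolding rq by (simp add: in_prime_factors_iff)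
    then have "int q dvd int (a q)"
      using prime_dvd_partial_fraction_numerator_iff[OF finite_set_mset prime q, where c = "\<lambda>p. int (a p)"]
        r(2) unfolding A_def rq by simp
    then have "q dvd a q" by simp
    moreover have "1 \<le> a q" "a q < q" using a q by (auto simp: residue_vectors_def PiE_iff)
    ultimately show False by (auto dest: dvd_imp_le)
  qed
  ultimately show ?thesis using d(1) unfolding reduced_fractions_def by blast
qed

text \<open>Extended by 0 to the union of both prime sets, the coordinates agree modulo each prime
  and lie in [0, q), so they coincide. Genuine coordinates are nonzero, so their support recovers
  the primes of \<open>d\<close>.\<close>

lemma partial_fraction_inj_mod_1:
  assumes d: "d = \<Prod>(prime_factors d)" and e: "e = \<Prod>(prime_factors e)"
    and a: "a \<in> residue_vectors d" and b: "b \<in> residue_vectors e"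
    and int: "partial_fraction d a - partial_fraction e b \<in> \<int>"
  shows "d = e \<and> a = b"
proof -
  define F where "F = prime_factors d \<union> prime_factors e"
  define a' where "a' p = (if p \<in> prime_factors d then int (a p) else 0)" for p
  define b' where "b' p = (if p \<in> prime_factors e then int (b p) else 0)" for p
  have fin: "finite F" by (simp add: F_def)
  have prime: "\<And>p. p \<in> F \<Longrightarrow> prime p" by (auto simp: F_def in_prime_factors_iff)
  have "partial_fraction d a = (\<Sum>p\<in>F. of_int (a' p) / real p)"
    unfolding partial_fraction_def a'_def by (rule sum.mono_neutral_cong_left) (auto simp: F_def)
  moreover have "partial_fraction e b = (\<Sum>p\<in>F. of_int (b' p) / real p)"
    unfolding partial_fraction_def b'_def by (rule sum.mono_neutral_cong_left) (auto simp: F_def)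
  ultimately have "(\<Sum>p\<in>F. of_int (a' p - b' p) / real p) \<in> \<int>"
    using int by (simp add: diff_divide_distrib sum_subtractf)
  from dvd_of_partial_fractions_in_Ints[OF fin prime this]
  have dvd: "int q dvd a' q - b' q" if "q \<in> F" for q using that by blast
  have a_range: "1 \<le> a p \<and> a p < p" if "p \<in> prime_factors d" for p
    using a that by (auto simp: residue_vectors_def PiE_iff)
  have b_range: "1 \<le> b p \<and> b p < p" if "p \<in> prime_factors e" for p
    using b that by (auto simp: residue_vectors_def PiE_iff)
  have eq: "a' q = b' q" for q
  proof (cases "q \<in> F")
    case True
    have "0 < q" using prime[OF True] by (rule prime_gt_0_nat)
    then have "0 \<le> a' q" "a' q < int q" "0 \<le> b' q" "b' q < int q"
      using a_range[of q] b_range[of q] by (auto simp: a'_def b'_def)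
    then show ?thesis using dvd[OF True] by (metis mod_eq_dvd_iff mod_pos_pos_trivial)
  qed (simp add: F_def a'_def b'_def)
  have "p \<in> prime_factors d \<longleftrightarrow> p \<in> prime_factors e" for p
    using eq[of p] a_range[of p] b_range[of p] by (auto simp: a'_def b'_def split: if_splits)
  then have same: "prime_factors d = prime_factors e" by blast
  then have "d = e" using d e by metis
  moreover have "a = b"
  proof (rule PiE_ext)
    show "a \<in> (\<Pi>\<^sub>E p\<in>prime_factors d. {1..<p})" using a by (simp add: residue_vectors_def)
    show "b \<in> (\<Pi>\<^sub>E p\<in>prime_factors d. {1..<p})" using b same by (simp add: residue_vectors_def)
    show "a p = b p" if "p \<in> prime_factors d" for p
      using eq[of p] that same by (simp add: a'_def b'_def)
  qed
  ultimately show ?thesis by blast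
qed

section \<open>Positive semidefinite kernels\<close>

lemma psd_on_add: "psd_on S A \<Longrightarrow> psd_on S B \<Longrightarrow> psd_on S (\<lambda>i j. A i j + B i j)"
  by (simp add: psd_on_def sym_on_def algebra_simps sum.distrib add_nonneg_nonneg)

lemma psd_on_scale:
  assumes "0 \<le> c" and "psd_on S A"
  shows "psd_on S (\<lambda>i j. c * A i j)"
proof -
  have "(\<Sum>i\<in>S. \<Sum>j\<in>S. x i * (c * A i j) * x j) = c * (\<Sum>i\<in>S. \<Sum>j\<in>S. x i * A i j * x j)" for x
    by (simp add: sum_distrib_left mult_ac)
  then show ?thesis using assms by (simp add: psd_on_def sym_on_def)
qed

lemma psd_on_cong:
  assumes "psd_on S A" and "\<And>i j. i \<in> S \<Longrightarrow> j \<in> S \<Longrightarrow> A i j = B i j"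
  shows "psd_on S B"
proof -
  have "(\<Sum>i\<in>S. \<Sum>j\<in>S. x i * B i j * x j) = (\<Sum>i\<in>S. \<Sum>j\<in>S. x i * A i j * x j)" for x
    using assms(2) by (intro sum.cong refl) simp
  moreover have "sym_on S B" using assms by (simp add: psd_on_def sym_on_def)
  ultimately show ?thesis using assms(1) by (simp add: psd_on_def)
qed

lemma psd_on_const:
  assumes "0 \<le> c"
  shows "psd_on S (\<lambda>i j. c)"
proof -
  have "(\<Sum>i\<in>S. \<Sum>j\<in>S. x i * c * x j) = c * (\<Sum>i\<in>S. x i)\<^sup>2" for x
    by (simp add: power2_eq_square sum_product sum_distrib_left mult_ac)
  then show ?thesis using assms by (simp add: psd_on_def sym_on_def)
qed

text \<open>A case of the Schur product theorem: multiplying by a rank one kernel merely replaces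
  the test vector \<open>x i\<close> by \<open>x i * w c i\<close>.\<close>

lemma psd_on_mult_gram:
  assumes "psd_on S A"
  shows "psd_on S (\<lambda>i j. A i j * (\<Sum>c\<in>C. w c i * w c j))"
proof -
  have "0 \<le> (\<Sum>i\<in>S. \<Sum>j\<in>S. x i * (A i j * (\<Sum>c\<in>C. w c i * w c j)) * x j)" for x
  proof -
    have "0 \<le> (\<Sum>i\<in>S. \<Sum>j\<in>S. y i * A i j * y j)" for y
      using assms by (simp add: psd_on_def)
    from this[of "\<lambda>i. x i * w _ i"]
    have "0 \<le> (\<Sum>c\<in>C. \<Sum>i\<in>S. \<Sum>j\<in>S. (x i * w c i) * A i j * (x j * w c j))"
      by (rule sum_nonneg)
    also have "\<dots> = (\<Sum>i\<in>S. \<Sum>c\<in>C. \<Sum>j\<in>S. (x i * w c i) * A i j * (x j * w c j))"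
      by (rule sum.swap)
    also have "\<dots> = (\<Sum>i\<in>S. \<Sum>j\<in>S. \<Sum>c\<in>C. (x i * w c i) * A i j * (x j * w c j))"
      by (intro sum.cong refl sum.swap)
    also have "\<dots> = (\<Sum>i\<in>S. \<Sum>j\<in>S. x i * (A i j * (\<Sum>c\<in>C. w c i * w c j)) * x j)"
      by (simp add: sum_distrib_left sum_distrib_right mult_ac)
    finally show ?thesis .
  qed
  then show ?thesis using assms by (simp add: psd_on_def sym_on_def mult.commute)
qed

text \<open>With h = \<Prod>f - pc for the earlier primes and c + g for the new factor, (c + g)(h +
  pc) - c pc = c h + h g + pc g, a sum of positive semidefinite kernels.\<close>

lemma psd_on_prod_minus_prod:
  fixes f :: "'p \<Rightarrow> int \<Rightarrow> int \<Rightarrow> real"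
  assumes "finite F" and "\<And>p. p \<in> F \<Longrightarrow> 0 \<le> c p"
    and "\<And>p i j. p \<in> F \<Longrightarrow> i \<in> S \<Longrightarrow> j \<in> S \<Longrightarrow> f p i j = c p + (\<Sum>a\<in>C p. w p a i * w p a j)"
  shows "psd_on S (\<lambda>i j. (\<Prod>p\<in>F. f p i j) - (\<Prod>p\<in>F. c p))"
  using assms
proof (induction F rule: finite_induct)
  case empty
  then show ?case using psd_on_const[of 0 S] by simp
next
  case (insert q F)
  define g where "g = (\<lambda>i j. \<Sum>a\<in>C q. w q a i * w q a j)"
  define pc where "pc = (\<Prod>p\<in>F. c p)"
  define h where "h = (\<lambda>i j. (\<Prod>p\<in>F. f p i j) - pc)"
  have pc: "0 \<le> pc" using insert.prems by (simp add: pc_def prod_nonneg)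
  have h: "psd_on S h" unfolding h_def pc_def using insert.prems by (intro insert.IH) auto
  have cq: "0 \<le> c q" using insert.prems by simp
  have "psd_on S (\<lambda>i j. (c q * h i j + h i j * g i j) + pc * g i j)"
    unfolding g_def
    by (intro psd_on_add psd_on_scale[OF cq h] psd_on_mult_gram h psd_on_const[OF pc])
  then show ?case
  proof (rule psd_on_cong)
    fix i j assume "i \<in> S" "j \<in> S"
    then have "f q i j = c q + g i j" using insert.prems by (simp add: g_def)
    then show "c q * h i j + h i j * g i j + pc * g i j
        = (\<Prod>p\<in>insert q F. f p i j) - (\<Prod>p\<in>insert q F. c p)"
      using insert.hyps by (simp add: h_def pc_def algebra_simps)
  qed
qed

section \<open>Kernels on the surviving residue classes\<close>

text \<open>On the n = p - k remaining classes, the indicators centred by 1/n have Gram matrix I -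
  J/n. Scaling by p leaves the constant p/n - 1 = k/n.\<close>

lemma residue_kernel_gram:
  fixes p k :: nat and R :: "int set"
  assumes R: "R \<subseteq> {0..<int p}" "card R = k" and k: "k < p"
    and i: "i mod int p \<notin> R" and j: "j mod int p \<notin> R"
  defines "C \<equiv> {0..<int p} - R"
    and "w \<equiv> \<lambda>a i. sqrt (real p) * (of_bool (i mod int p = a) - 1 / (real p - real k))"
  shows "real p * of_bool (int p dvd i - j) - 1
           = real k / (real p - real k) + (\<Sum>a\<in>C. w a i * w a j)"
proof -
  define n where "n = real p - real k"
  have n: "n > 0" using k by (simp add: n_def)
  have finC: "finite C" by (simp add: C_def)
  have cardC: "real (card C) = n"
  proof -
    have "card C = p - k"
      unfolding C_def using R finite_subset[OF R(1)] by (subst card_Diff_subset) auto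
    then show ?thesis using k by (simp add: n_def of_nat_diff)
  qed
  have ic: "i mod int p \<in> C" "j mod int p \<in> C" using i j k by (auto simp: C_def)
  have "w a i * w a j = real p * ((if a = i mod int p then of_bool (j mod int p = i mod int p) else 0)
      - (if a = i mod int p then 1 / n else 0) - (if a = j mod int p then 1 / n else 0) + 1 / n\<^sup>2)" for a
  proof -
    have sq: "sqrt (real p) * sqrt (real p) = real p" by simp
    have "w a i * w a j = (sqrt (real p) * sqrt (real p)) *
        ((of_bool (i mod int p = a) - 1 / n) * (of_bool (j mod int p = a) - 1 / n))"
      by (simp only: w_def n_def mult_ac)
    then show ?thesis unfolding sq by (auto simp: power2_eq_square algebra_simps)
  qed
  then have "(\<Sum>a\<in>C. w a i * w a j)
      = real p * (of_bool (j mod int p = i mod int p) - 1 / n - 1 / n + n * (1 / n\<^sup>2))"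
    using finC ic cardC by (simp add: sum.distrib sum_subtractf flip: sum_distrib_left)
  also have "n * (1 / n\<^sup>2) = 1 / n" using n by (simp add: power2_eq_square)
  also have "j mod int p = i mod int p \<longleftrightarrow> int p dvd i - j"
    by (metis mod_eq_dvd_iff)
  finally have "(\<Sum>a\<in>C. w a i * w a j) = real p * of_bool (int p dvd i - j) - real p / n"
    by (simp add: algebra_simps)
  moreover have "real p / n = 1 + real k / n" using n by (simp add: n_def field_simps)
  ultimately show ?thesis by (simp add: n_def)
qed

lemma M_mat_sym: "M_mat d i j = M_mat d j i"
  unfolding M_mat_def by (simp add: dvd_diff_commute)

text \<open>The coefficient of J is the product over the primes of the constants from
  \<open>residue_kernel_gram\<close>.\<close>

lemma M_mat_minus_ones_in_B_class:
  assumes \<kappa>: "\<And>p. p \<in> prime_factors d \<Longrightarrow> \<kappa> p < p"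
  shows "(\<lambda>i j. M_mat d i j - kappa_prod \<kappa> d / phi_kappa \<kappa> d * ones_mat i j) \<in> B_class Z d \<kappa>"
proof -
  let ?B = "\<lambda>i j. M_mat d i j - kappa_prod \<kappa> d / phi_kappa \<kappa> d * ones_mat i j"
  have "psd_on (Z - {i. \<exists>p\<in>prime_factors d. i mod int p \<in> R p}) ?B"
    if R: "\<forall>p\<in>prime_factors d. R p \<subseteq> {0..<int p} \<and> card (R p) = \<kappa> p" for R :: "nat \<Rightarrow> int set"
  proof -
    let ?S = "Z - {i. \<exists>p\<in>prime_factors d. i mod int p \<in> R p}"
    have "psd_on ?S (\<lambda>i j. (\<Prod>p\<in>prime_factors d. real p * of_bool (int p dvd i - j) - 1)
        - (\<Prod>p\<in>prime_factors d. real (\<kappa> p) / (real p - real (\<kappa> p))))"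
    proof (rule psd_on_prod_minus_prod)
      show "0 \<le> real (\<kappa> p) / (real p - real (\<kappa> p))" if "p \<in> prime_factors d" for p
        using \<kappa>[OF that] by simp
      show "real p * of_bool (int p dvd i - j) - 1 = real (\<kappa> p) / (real p - real (\<kappa> p))
          + (\<Sum>a\<in>{0..<int p} - R p. sqrt (real p) * (of_bool (i mod int p = a) - 1 / (real p - real (\<kappa> p)))
              * (sqrt (real p) * (of_bool (j mod int p = a) - 1 / (real p - real (\<kappa> p)))))"
        if "p \<in> prime_factors d" "i \<in> ?S" "j \<in> ?S" for p i j
        using that R \<kappa>[OF that(1)] by (intro residue_kernel_gram) auto
    qed simp
    then show ?thesis
      by (simp add: M_mat_def kappa_prod_def phi_kappa_def ones_mat_def prod_dividef)
  qed
  moreover have "sym_on Z ?B" by (simp add: sym_on_def ones_mat_def M_mat_sym[of d])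
  ultimately show ?thesis by (simp add: B_class_def)
qed

lemma B_class_scale:
  assumes "0 \<le> c" and "B \<in> B_class Z d \<kappa>"
  shows "(\<lambda>i j. c * B i j) \<in> B_class Z d \<kappa>"
  using assms by (auto simp: B_class_def sym_on_def intro: psd_on_scale)

section \<open>Assembly of the decomposition\<close>

lemma sum_M_mat_quadratic_form_le:
  assumes "finite D" and D: "\<And>d. d \<in> D \<Longrightarrow> d = \<Prod>(prime_factors d)"
    and \<delta>: "0 < \<delta>" "\<delta> \<le> 1" and N: "N \<ge> 1"
    and spaced: "spaced_mod_1 \<delta> (reduced_fractions D)"
  shows "(\<Sum>i\<in>{m..<m + int N}. \<Sum>j\<in>{m..<m + int N}. x i * (\<Sum>d\<in>D. M_mat d i j) * x j)
           \<le> (real N + 1 / \<delta> - 1) * (\<Sum>i\<in>{m..<m + int N}. (x i)\<^sup>2)"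
proof -
  define S where "S = (SIGMA d:D. residue_vectors d)"
  define \<alpha> where "\<alpha> = (\<lambda>(d, a). partial_fraction d a)"
  have fin_rv: "finite (residue_vectors d)" for d
    unfolding residue_vectors_def by (intro finite_PiE) auto
  then have finS: "finite S" using assms(1) by (simp add: S_def)
  have M: "(\<Sum>d\<in>D. M_mat d i j) = (\<Sum>r\<in>S. cos (2 * pi * \<alpha> r * of_int (i - j)))" for i j
    unfolding M_mat_eq_sum_cos S_def \<alpha>_def using assms(1) fin_rv
    by (subst sum.Sigma) (auto intro!: sum.cong)
  have sp: "\<delta> \<le> \<bar>\<alpha> s - \<alpha> t - of_int k\<bar>" if st: "s \<in> S" "t \<in> S" "s \<noteq> t" for s t k
  proof -
    obtain d a where s: "s = (d, a)" "d \<in> D" "a \<in> residue_vectors d" using st(1) by (auto simp: S_def)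
    obtain e b where t: "t = (e, b)" "e \<in> D" "b \<in> residue_vectors e" using st(2) by (auto simp: S_def)
    have "\<alpha> s \<in> reduced_fractions D" "\<alpha> t \<in> reduced_fractions D"
      using partial_fraction_in_reduced_fractions[OF s(2) D s(3)]
        partial_fraction_in_reduced_fractions[OF t(2) D t(3)] s t by (auto simp: \<alpha>_def)
    \<comment> \<open>\<open>spaced_mod_1\<close> constrains only points that differ modulo 1, so
      distinct indices must first be shown to give distinct points.\<close>
    moreover have "\<alpha> s - \<alpha> t \<notin> \<int>"
      using partial_fraction_inj_mod_1[OF D[OF s(2)] D[OF t(2)] s(3) t(3)] s t st(3)
      by (auto simp: \<alpha>_def)
    ultimately have "\<delta> \<le> infdist (\<alpha> s - \<alpha> t) \<int>" using spaced by (simp add: spaced_mod_1_def)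
    also have "\<dots> \<le> dist (\<alpha> s - \<alpha> t) (of_int k)" by (rule infdist_le) simp
    finally show ?thesis by (simp add: dist_real_def)
  qed
  show ?thesis unfolding M using finS \<delta> N sp by (intro large_sieve) auto
qed

lemma squarefree_product_prime_factors:
  fixes P :: "nat set"
  assumes "finite P" and "\<And>p. p \<in> P \<Longrightarrow> prime p" and "\<exists>S\<subseteq>P. d = \<Prod>S"
  shows "d = \<Prod>(prime_factors d)" and "prime_factors d \<subseteq> P"
proof -
  from assms(3) obtain S where S: "S \<subseteq> P" "d = \<Prod>S" by blast
  have "prime_factors d = S"
    unfolding S(2) using assms S(1) by (intro prime_factors_prod_primes) (auto intro: finite_subset)
  then show "d = \<Prod>(prime_factors d)" "prime_factors d \<subseteq> P" using S by auto
qed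

theorem mainTheorem3:
  fixes Z :: "int set" and m :: int and N :: nat
    and P :: "nat set" and \<kappa> :: "nat \<Rightarrow> nat" and D :: "nat set" and \<delta> :: real
  assumes "N \<ge> 1" and "Z = {m..<m + int N}"
    and "finite P" and "\<And>p. p \<in> P \<Longrightarrow> prime p"
    and "\<And>p. p \<in> P \<Longrightarrow> \<kappa> p < p"
    and "finite D" and "\<And>d. d \<in> D \<Longrightarrow> \<exists>S\<subseteq>P. d = \<Prod>S" and "1 \<in> D"
    and "0 < \<delta>" and "\<delta> \<le> 1"
    and "spaced_mod_1 \<delta> (reduced_fractions D)"
  shows "psd_on Z (B_mat N \<delta> \<kappa> D 1) \<and>
    (\<forall>d\<in>D. d > 1 \<longrightarrow> B_mat N \<delta> \<kappa> D d \<in> B_class Z d \<kappa>) \<and>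
    (\<forall>i\<in>Z. \<forall>j\<in>Z. (\<Sum>d\<in>D. B_mat N \<delta> \<kappa> D d i j) + ones_mat i j =
      (real N + inverse \<delta> - 1) / (\<Sum>d\<in>D. kappa_prod \<kappa> d / phi_kappa \<kappa> d) * id_mat i j)"
proof -
  define G where "G = G_sum \<kappa> D"
  define g where "g d = kappa_prod \<kappa> d / phi_kappa \<kappa> d" for d
  define \<Delta> where "\<Delta> = real N + inverse \<delta> - 1"
  note facts = squarefree_product_prime_factors[OF assms(3,4,7)]
  have \<kappa>: "\<kappa> p < p" if "d \<in> D" "p \<in> prime_factors d" for d p
    using facts(2)[OF _ that(1)] that assms(5) by blast
  have g1: "g 1 = 1" by (simp add: g_def kappa_prod_def phi_kappa_def)
  have g0: "0 \<le> g d" if "d \<in> D" for d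
    unfolding g_def kappa_prod_def phi_kappa_def using \<kappa>[OF that]
    by (intro divide_nonneg_nonneg prod_nonneg) (auto simp: less_imp_le)
  \<comment> \<open>The index 1 contributes an empty product and all other terms are nonnegative, so
    G \<ge> 1.\<close>
  have G_split: "G = 1 + (\<Sum>d\<in>D-{1}. g d)"
    unfolding G_def G_sum_def using sum.remove[OF assms(6,8), of g] g1 by (simp add: g_def)
  have "0 \<le> (\<Sum>d\<in>D-{1}. g d)" using g0 by (intro sum_nonneg) auto
  then have G: "G > 0" using G_split by simp
  have "psd_on Z (\<lambda>i j. 1 / G * (\<Delta> * id_mat i j - (\<Sum>d\<in>D. M_mat d i j)))"
  proof (rule psd_on_scale)
    show "psd_on Z (\<lambda>i j. \<Delta> * id_mat i j - (\<Sum>d\<in>D. M_mat d i j))"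
      unfolding psd_on_def
    proof (intro conjI allI)
      show "sym_on Z (\<lambda>i j. \<Delta> * id_mat i j - (\<Sum>d\<in>D. M_mat d i j))"
        unfolding sym_on_def using M_mat_sym by (auto simp: id_mat_def)
      fix x
      have "(\<Sum>i\<in>Z. \<Sum>j\<in>Z. x i * (\<Sum>d\<in>D. M_mat d i j) * x j) \<le> \<Delta> * (\<Sum>i\<in>Z. (x i)\<^sup>2)"
        unfolding \<Delta>_def assms(2) inverse_eq_divide
        using assms facts(1) by (intro sum_M_mat_quadratic_form_le) auto
      also have "(\<Sum>i\<in>Z. (x i)\<^sup>2) = (\<Sum>i\<in>Z. \<Sum>j\<in>Z. x i * id_mat i j * x j)"
      proof (intro sum.cong refl)
        fix i assume "i \<in> Z"
        have "(\<Sum>j\<in>Z. x i * id_mat i j * x j) = (\<Sum>j\<in>Z. if i = j then (x i)\<^sup>2 else 0)"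
          by (intro sum.cong) (auto simp: id_mat_def power2_eq_square)
        then show "(x i)\<^sup>2 = (\<Sum>j\<in>Z. x i * id_mat i j * x j)"
          using \<open>i \<in> Z\<close> assms(2) by simp
      qed
      finally show "0 \<le> (\<Sum>i\<in>Z. \<Sum>j\<in>Z. x i * (\<Delta> * id_mat i j - (\<Sum>d\<in>D. M_mat d i j)) * x j)"
        by (simp only: right_diff_distrib left_diff_distrib sum_subtractf sum_distrib_left)
          (simp add: mult_ac)
    qed
  qed (use G in simp)
  moreover have "B_mat N \<delta> \<kappa> D 1 = (\<lambda>i j. 1 / G * (\<Delta> * id_mat i j - (\<Sum>d\<in>D. M_mat d i j)))"
    by (intro ext) (simp add: B_mat_def G_def \<Delta>_def)
  ultimately have "psd_on Z (B_mat N \<delta> \<kappa> D 1)" by simp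
  moreover have "B_mat N \<delta> \<kappa> D d \<in> B_class Z d \<kappa>" if "d \<in> D" "d > 1" for d
  proof -
    have "B_mat N \<delta> \<kappa> D d = (\<lambda>i j. 1 / G * (M_mat d i j - kappa_prod \<kappa> d / phi_kappa \<kappa> d * ones_mat i j))"
      using that by (intro ext) (simp add: B_mat_def G_def)
    moreover have "(\<lambda>i j. 1 / G * (M_mat d i j - kappa_prod \<kappa> d / phi_kappa \<kappa> d * ones_mat i j)) \<in> B_class Z d \<kappa>"
      using G \<kappa>[OF that(1)] by (intro B_class_scale M_mat_minus_ones_in_B_class) auto
    ultimately show ?thesis by simp
  qed
  moreover have "(\<Sum>d\<in>D. B_mat N \<delta> \<kappa> D d i j) + ones_mat i j
      = \<Delta> / (\<Sum>d\<in>D. g d) * id_mat i j" for i j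
  proof -
    have Gg: "(\<Sum>d\<in>D. g d) = G" by (simp add: G_def G_sum_def g_def)
    \<comment> \<open>Removing d = 1 lowers both the sum of the M_d and the sum of the coefficients
      by J, so the two losses cancel. Adding B^1 then cancels the M_d and leaves -J beside the
      multiple of I.\<close>
    have "(\<Sum>d\<in>D-{1}. B_mat N \<delta> \<kappa> D d i j) = (\<Sum>d\<in>D-{1}. 1 / G * (M_mat d i j - g d))"
      by (intro sum.cong refl) (simp add: B_mat_def G_def g_def ones_mat_def)
    also have "\<dots> = 1 / G * ((\<Sum>d\<in>D-{1}. M_mat d i j) - (\<Sum>d\<in>D-{1}. g d))"
      by (simp only: sum_distrib_left sum_subtractf[symmetric])
    also have "(\<Sum>d\<in>D-{1}. M_mat d i j) = (\<Sum>d\<in>D. M_mat d i j) - 1"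
      using sum.remove[OF assms(6,8), of "\<lambda>d. M_mat d i j"] by (simp add: M_mat_def)
    also have "(\<Sum>d\<in>D-{1}. g d) = G - 1" using G_split by simp
    finally have rest: "(\<Sum>d\<in>D-{1}. B_mat N \<delta> \<kappa> D d i j) = 1 / G * ((\<Sum>d\<in>D. M_mat d i j) - G)"
      by simp
    have "(\<Sum>d\<in>D. B_mat N \<delta> \<kappa> D d i j)
        = 1 / G * (\<Delta> * id_mat i j - (\<Sum>d\<in>D. M_mat d i j)) + 1 / G * ((\<Sum>d\<in>D. M_mat d i j) - G)"
      unfolding rest[symmetric] using sum.remove[OF assms(6,8), of "\<lambda>d. B_mat N \<delta> \<kappa> D d i j"]
      by (simp add: B_mat_def G_def \<Delta>_def)
    also have "\<dots> = \<Delta> / G * id_mat i j - 1" using G by (simp add: right_diff_distrib)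
    finally show ?thesis unfolding Gg ones_mat_def by simp
  qed
  ultimately show ?thesis by (simp add: \<Delta>_def g_def)
qed

end
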